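(* Let $\mathcal S$ be a cloven flexible-limit 2-sketch, and denote by $\Psi := \{ W^\Omega \mid W \in \mathcal S \}$ the class of $\mathcal F$-weights induced by the cleavages $\Omega$ of the weights $W$ of $\mathcal S$. For each weakness $w \in \{s,p,l,c\}$ and each limit 2-sketch $\mathcal C$, there is a 2-natural isomorphism of 2-categories $$\mathrm{Mod}_w(\mathcal S, \mathcal C) \cong (\mathbb{M}\mathrm{od}_w(\mathcal S^\Psi, \mathcal C^+))_\lambda,$$ where $\mathcal S^\Psi$ denotes the free $\Psi$-limit $\mathcal F$-sketch associated to the $\Psi_\lambda$-limit 2-sketch underlying $\mathcal S$.
   Context: **$\mathcal F$-categories.** $\mathcal F$ is the full subcategory of the arrow category $\mathrm{CAT}^{\to}$ of the category of small categories spanned by the full embeddings $A\colon A_\tau \to A_\lambda$ (fully faithful, injective-on-objects functors). An $\mathcal F$-category $\mathbb C$ is a category enriched in the cartesian closed category $\mathcal F$; equivalently, a 2-category $\mathbb C_\lambda$, whose 1-cells are called loose morphisms, with a wide, locally full sub-2-category $\mathbb C_\tau$, whose 1-cells are called tight. An $\mathcal F$-functor is a 2-functor $\mathbb C_\lambda\to\mathbb D_\lambda$ preserving tightness. $\mathbb F$ is $\mathcal F$ as an $\mathcal F$-category: loose morphisms $A\to B$ are functors $A_\lambda\to B_\lambda$, the tight ones those restricting to $A_\tau \to B_\tau$. For a 2-category $\mathscr K$, $\mathscr K^+$ (chordate) and $\mathscr K^-$ (inchordate) are the $\mathcal F$-categories on $\mathscr K$ in which all morphisms, respectively only identities, are tight.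 **Sketches.** For $\mathcal V=\mathrm{CAT}$ or $\mathcal F$: a $\mathcal V$-weight is a $\mathcal V$-functor $W\colon\mathscr J\to\mathcal V$ with $\mathscr J$ small; a $W$-weighted cone over $D\colon\mathscr J\to\mathscr S$ is an object $X$ with a $\mathcal V$-natural $\gamma\colon W\Rightarrow\mathscr S(X,D-)$; a (limit) $\mathcal V$-sketch is a small $\mathcal V$-category with a class of weighted cones, and it is a $\Psi$-limit sketch if all its weights lie in the class $\Psi$; a model (sketch morphism) is a $\mathcal V$-functor sending specified cones to specified cones. 2-sketch means $\mathrm{CAT}$-sketch. For $\mathcal V=\mathrm{CAT}$, a $W$-weighted cone $\gamma$ has cone projections $\gamma_{J,Y}\colon X\to D(J)$ for $J\in\mathscr J$ and $Y\in W(J)$. An $\mathcal F$-weight $W$ or $\mathcal F$-weighted cone $\gamma$ has a loose part $W_\lambda\colon \mathbb J_\lambda\to\mathrm{CAT}$, $\gamma_\lambda$, and $\Psi_\lambda=\{W_\lambda\mid W\in\Psi\}$. **Flexible weights and cleavages.** For $W\colon\mathscr J\to\mathrm{CAT}$, let $\mathrm{el}(\mathrm{ob}\circ W_0)$ be the category with objects pairs $(J\in\mathscr J,Y\in W(J))$ and morphisms $(J,Y)\to(J',Y')$ the 1-cells $f\colon J\to J'$ with $W(f)(Y)=Y'$. $W$ is flexible if it lies in the saturation of the weights for products, inserters, equifiers and splittings of idempotents; equivalently, each connected component of $\mathrm{el}(\mathrm{ob}\circ W_0)$ admits a naturally weakly initial object, i.e. an object $I$ with morphisms $i_A\colon I\to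 A$ for every object $A$ of the component such that $f\circ i_A=i_B$ for every $f\colon A\to B$. A cleavage $\Omega$ for $W$ is a choice, for each connected component, of such $(I,i)$. Write $(J,Y)\in\Omega$ if $(J,Y)$ is one of the chosen objects; the corresponding $\gamma_{J,Y}$ are called initial cone projections. The induced $\mathcal F$-weight $W^\Omega\colon\mathscr J^-\to\mathbb F$ sends $J$ to the inclusion into $W(J)$ of the full subcategory on those $Y$ with $(J,Y)\in\Omega$, and acts on 1-cells and 2-cells as $W$; thus $(W^\Omega)_\lambda=W$. **Cloven flexible-limit 2-sketches.** Such an $\mathcal S$ is a limit 2-sketch (on a 2-category $\mathscr S$) each of whose weights is flexible, together with a cleavage for each weight. For a 2-sketch $\mathcal C$ on a 2-category $\mathscr C$, $\mathrm{Mod}_w(\mathcal S,\mathcal C)$ is the 2-category whose objects are models $\mathscr S\to\mathscr C$ of the underlying 2-sketch, whose 1-cells are $w$-natural transformations $\phi$ (2-natural, pseudonatural, lax natural, colax natural for $w=s,p,l,c$) such that $\phi_{\gamma_{J,Y}}$ is an identity for each initial cone projection $\gamma_{J,Y}$, and whose 2-cells are modifications. **The $\mathcal F$-sketches.** $\mathcal S^\Psi$ has underlying 2-category of loose morphisms $\mathscr S$; its tight morphisms are generated under identities and composition by: for each $W\colon\mathbb J\to\mathbb F$ in $\Psi$, $D\colon\mathbb J_\lambda\to\mathscr S$ and specified cone $\gamma\colon W_\lambda\Rightarrow\mathscr S(X,D-)$ of $\mathcal S$, the morphisms $D(f)$ for $f$ tight in $\mathbb J$, and the projections $\gamma_{J,Y}$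 for $Y\in W(J)_\tau$. Its specified cones are these $(W,D,X,\gamma)$, regarded as $\mathcal F$-weighted cones. $\mathcal C^+$ is the $\mathcal F$-sketch obtained from $\mathcal C$ by change of base along the chordate construction: its underlying $\mathcal F$-category is the chordate $\mathscr C^+$, and for each specified cone $\gamma\colon W\Rightarrow\mathscr C(X,D-)$ of $\mathcal C$, with $W\colon\mathscr J\to\mathrm{CAT}$ and $D\colon\mathscr J\to\mathscr C$, it has the specified $\mathcal F$-weighted cone $\gamma^+\colon W^+\Rightarrow\mathscr C^+(X,D^+-)$ with the same components as $\gamma$. Here $D^+\colon\mathscr J^+\to\mathscr C^+$ is $D$ regarded as an $\mathcal F$-functor, and $W^+\colon\mathscr J^+\to\mathbb F$ is the $\mathcal F$-weight whose value at $J$ is the identity on $W(J)$. **Models.** $\mathbb{M}\mathrm{od}_w(\mathcal A,\mathcal B)$, for $\mathcal F$-sketches $\mathcal A,\mathcal B$, is the $\mathcal F$-category whose objects are the models of $\mathcal A$ in $\mathcal B$; whose loose morphisms are the $w$-natural transformations between the underlying 2-functors on loose parts whose 2-cell components at tight morphisms are identities; in which such a morphism is tight when its 1-cell components are tight and all its 2-cell components are identities; and whose 2-cells are modifications. The subscript $(-)_\lambda$ denotes the underlying 2-category of loose morphisms.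
   Formalization: A model of F-sketches is taken to send each specified cone to a restriction (same loose part, possibly fewer tight data) of a specified cone; with literal equality an inserter cone, over the inchordate index, would leave no models in the chordate sketch and the claim would fail. *)

theory Defs
  imports "HOL-Library.FuncSet"
begin

section \<open>Categories and functors\<close>

text \<open>
  Carriers are sets, so every structure below is small.  All maps that make up functors,
  transformations, weights and cones are extensional (undefined off their carrier), so that
  HOL equality of these data is equality of the mathematical objects.
\<close>

record ('o, 'a) cat =
  Ob :: "'o set"
  Ar :: "'a set"
  Dom :: "'a \<Rightarrow> 'o"
  Cod :: "'a \<Rightarrow> 'o"
  Id :: "'o \<Rightarrow> 'a"
  Comp :: "'a \<Rightarrow> 'a \<Rightarrow> 'a"  (infixr "\<cdot>\<index>" 70)

locale category =
  fixes A :: "('o, 'a) cat" (structure)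
  assumes dom_ob: "a \<in> Ar A \<Longrightarrow> Dom A a \<in> Ob A"
    and cod_ob: "a \<in> Ar A \<Longrightarrow> Cod A a \<in> Ob A"
    and id_ar: "x \<in> Ob A \<Longrightarrow> Id A x \<in> Ar A"
    and dom_id: "x \<in> Ob A \<Longrightarrow> Dom A (Id A x) = x"
    and cod_id: "x \<in> Ob A \<Longrightarrow> Cod A (Id A x) = x"
    and comp_ar: "\<lbrakk>a \<in> Ar A; b \<in> Ar A; Cod A a = Dom A b\<rbrakk> \<Longrightarrow> b \<cdot> a \<in> Ar A"
    and dom_comp: "\<lbrakk>a \<in> Ar A; b \<in> Ar A; Cod A a = Dom A b\<rbrakk> \<Longrightarrow> Dom A (b \<cdot> a) = Dom A a"
    and cod_comp: "\<lbrakk>a \<in> Ar A; b \<in> Ar A; Cod A a = Dom A b\<rbrakk> \<Longrightarrow> Cod A (b \<cdot> a) = Cod A b"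
    and id_left: "a \<in> Ar A \<Longrightarrow> Id A (Cod A a) \<cdot> a = a"
    and id_right: "a \<in> Ar A \<Longrightarrow> a \<cdot> Id A (Dom A a) = a"
    and assoc: "\<lbrakk>a \<in> Ar A; b \<in> Ar A; c \<in> Ar A; Cod A a = Dom A b; Cod A b = Dom A c\<rbrakk>
      \<Longrightarrow> (c \<cdot> b) \<cdot> a = c \<cdot> (b \<cdot> a)"

record ('o, 'a, 'p, 'b) func =
  fob :: "'o \<Rightarrow> 'p"
  far :: "'a \<Rightarrow> 'b"

locale cat_functor =
  fixes A :: "('o, 'a) cat" and B :: "('p, 'b) cat" and F :: "('o, 'a, 'p, 'b) func"
  assumes fob_ext: "fob F \<in> extensional (Ob A)"
    and far_ext: "far F \<in> extensional (Ar A)"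
    and fob_in: "x \<in> Ob A \<Longrightarrow> fob F x \<in> Ob B"
    and far_in: "a \<in> Ar A \<Longrightarrow> far F a \<in> Ar B"
    and far_dom: "a \<in> Ar A \<Longrightarrow> Dom B (far F a) = fob F (Dom A a)"
    and far_cod: "a \<in> Ar A \<Longrightarrow> Cod B (far F a) = fob F (Cod A a)"
    and far_id: "x \<in> Ob A \<Longrightarrow> far F (Id A x) = Id B (fob F x)"
    and far_comp: "\<lbrakk>a \<in> Ar A; b \<in> Ar A; Cod A a = Dom A b\<rbrakk>
      \<Longrightarrow> far F (b \<cdot>\<^bsub>A\<^esub> a) = far F b \<cdot>\<^bsub>B\<^esub> far F a"

definition id_func :: "('o, 'a) cat \<Rightarrow> ('o, 'a, 'o, 'a) func" where
  "id_func A = \<lparr>fob = (\<lambda>x\<in>Ob A. x), far = (\<lambda>a\<in>Ar A. a)\<rparr>"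

definition comp_func ::
  "('o, 'a) cat \<Rightarrow> ('p, 'b, 'q, 'c) func \<Rightarrow> ('o, 'a, 'p, 'b) func \<Rightarrow> ('o, 'a, 'q, 'c) func" where
  "comp_func A G F =
     \<lparr>fob = (\<lambda>x\<in>Ob A. fob G (fob F x)), far = (\<lambda>a\<in>Ar A. far G (far F a))\<rparr>"

definition nat_trans ::
  "('o, 'a) cat \<Rightarrow> ('p, 'b) cat \<Rightarrow> ('o, 'a, 'p, 'b) func \<Rightarrow> ('o, 'a, 'p, 'b) func
    \<Rightarrow> ('o \<Rightarrow> 'b) \<Rightarrow> bool" where
  "nat_trans A B F G \<tau> \<longleftrightarrow>
     \<tau> \<in> extensional (Ob A) \<and>
     (\<forall>x\<in>Ob A. \<tau> x \<in> Ar B \<and> Dom B (\<tau> x) = fob F x \<and> Cod B (\<tau> x) = fob G x) \<and>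
     (\<forall>a\<in>Ar A. \<tau> (Cod A a) \<cdot>\<^bsub>B\<^esub> far F a = far G a \<cdot>\<^bsub>B\<^esub> \<tau> (Dom A a))"


section \<open>2-categories and 2-functors\<close>

text \<open>Composition is written in the order of application: \<open>g \<odot> f\<close> is \<open>f\<close> followed by \<open>g\<close>.\<close>

record ('o, 'm, 'n) twocat =
  obj :: "'o set"
  ar1 :: "'m set"
  s1 :: "'m \<Rightarrow> 'o"
  t1 :: "'m \<Rightarrow> 'o"
  id1 :: "'o \<Rightarrow> 'm"
  comp1 :: "'m \<Rightarrow> 'm \<Rightarrow> 'm"  (infixr "\<odot>\<index>" 70)
  ar2 :: "'n set"
  s2 :: "'n \<Rightarrow> 'm"
  t2 :: "'n \<Rightarrow> 'm"
  id2 :: "'m \<Rightarrow> 'n"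
  vcomp :: "'n \<Rightarrow> 'n \<Rightarrow> 'n"  (infixr "\<bullet>\<index>" 65)
  hcomp :: "'n \<Rightarrow> 'n \<Rightarrow> 'n"  (infixr "\<star>\<index>" 70)

definition under_cat :: "('o, 'm, 'n) twocat \<Rightarrow> ('o, 'm) cat" where
  "under_cat C = \<lparr>Ob = obj C, Ar = ar1 C, Dom = s1 C, Cod = t1 C, Id = id1 C, Comp = comp1 C\<rparr>"

definition vert_cat :: "('o, 'm, 'n) twocat \<Rightarrow> ('m, 'n) cat" where
  "vert_cat C = \<lparr>Ob = ar1 C, Ar = ar2 C, Dom = s2 C, Cod = t2 C, Id = id2 C, Comp = vcomp C\<rparr>"

definition horiz_cat :: "('o, 'm, 'n) twocat \<Rightarrow> ('o, 'n) cat" where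
  "horiz_cat C = \<lparr>Ob = obj C, Ar = ar2 C, Dom = (\<lambda>a. s1 C (s2 C a)), Cod = (\<lambda>a. t1 C (t2 C a)),
     Id = (\<lambda>x. id2 C (id1 C x)), Comp = hcomp C\<rparr>"

locale two_category =
  fixes C :: "('o, 'm, 'n) twocat" (structure)
  assumes under_category: "category (under_cat C)"
    and vert_category: "category (vert_cat C)"
    and horiz_category: "category (horiz_cat C)"
    and globular_s: "a \<in> ar2 C \<Longrightarrow> s1 C (s2 C a) = s1 C (t2 C a)"
    and globular_t: "a \<in> ar2 C \<Longrightarrow> t1 C (s2 C a) = t1 C (t2 C a)"
    and s2_hcomp: "\<lbrakk>a \<in> ar2 C; b \<in> ar2 C; t1 C (s2 C a) = s1 C (s2 C b)\<rbrakk>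
      \<Longrightarrow> s2 C (b \<star> a) = s2 C b \<odot> s2 C a"
    and t2_hcomp: "\<lbrakk>a \<in> ar2 C; b \<in> ar2 C; t1 C (s2 C a) = s1 C (s2 C b)\<rbrakk>
      \<Longrightarrow> t2 C (b \<star> a) = t2 C b \<odot> t2 C a"
    and id2_comp1: "\<lbrakk>f \<in> ar1 C; g \<in> ar1 C; t1 C f = s1 C g\<rbrakk>
      \<Longrightarrow> id2 C (g \<odot> f) = id2 C g \<star> id2 C f"
    and interchange: "\<lbrakk>a \<in> ar2 C; a' \<in> ar2 C; b \<in> ar2 C; b' \<in> ar2 C;
        t2 C a = s2 C a'; t2 C b = s2 C b'; t1 C (s2 C a) = s1 C (s2 C b)\<rbrakk>
      \<Longrightarrow> (b' \<bullet> b) \<star> (a' \<bullet> a) = (b' \<star> a') \<bullet> (b \<star> a)"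

definition hom_cat :: "('o, 'm, 'n) twocat \<Rightarrow> 'o \<Rightarrow> 'o \<Rightarrow> ('m, 'n) cat" where
  "hom_cat C X Y =
     \<lparr>Ob = {f \<in> ar1 C. s1 C f = X \<and> t1 C f = Y},
      Ar = {a \<in> ar2 C. s1 C (s2 C a) = X \<and> t1 C (s2 C a) = Y},
      Dom = s2 C, Cod = t2 C, Id = id2 C, Comp = vcomp C\<rparr>"

definition is_identity2 :: "('o, 'm, 'n) twocat \<Rightarrow> 'n \<Rightarrow> bool" where
  "is_identity2 C a \<longleftrightarrow> a \<in> id2 C ` ar1 C"

definition is_invertible2 :: "('o, 'm, 'n) twocat \<Rightarrow> 'n \<Rightarrow> bool" where
  "is_invertible2 C a \<longleftrightarrow> a \<in> ar2 C \<and>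
     (\<exists>b\<in>ar2 C. s2 C b = t2 C a \<and> t2 C b = s2 C a \<and>
        b \<bullet>\<^bsub>C\<^esub> a = id2 C (s2 C a) \<and> a \<bullet>\<^bsub>C\<^esub> b = id2 C (t2 C a))"

record ('o, 'm, 'n, 'p, 'q, 'r) twofun =
  F0 :: "'o \<Rightarrow> 'p"
  F1 :: "'m \<Rightarrow> 'q"
  F2 :: "'n \<Rightarrow> 'r"

locale two_functor =
  fixes C :: "('o, 'm, 'n) twocat" and D :: "('p, 'q, 'r) twocat"
    and F :: "('o, 'm, 'n, 'p, 'q, 'r) twofun"
  assumes F0_ext: "F0 F \<in> extensional (obj C)"
    and F1_ext: "F1 F \<in> extensional (ar1 C)"
    and F2_ext: "F2 F \<in> extensional (ar2 C)"
    and F0_in: "x \<in> obj C \<Longrightarrow> F0 F x \<in> obj D"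
    and F1_in: "f \<in> ar1 C \<Longrightarrow> F1 F f \<in> ar1 D"
    and F2_in: "a \<in> ar2 C \<Longrightarrow> F2 F a \<in> ar2 D"
    and F1_s1: "f \<in> ar1 C \<Longrightarrow> s1 D (F1 F f) = F0 F (s1 C f)"
    and F1_t1: "f \<in> ar1 C \<Longrightarrow> t1 D (F1 F f) = F0 F (t1 C f)"
    and F2_s2: "a \<in> ar2 C \<Longrightarrow> s2 D (F2 F a) = F1 F (s2 C a)"
    and F2_t2: "a \<in> ar2 C \<Longrightarrow> t2 D (F2 F a) = F1 F (t2 C a)"
    and F1_id1: "x \<in> obj C \<Longrightarrow> F1 F (id1 C x) = id1 D (F0 F x)"
    and F2_id2: "f \<in> ar1 C \<Longrightarrow> F2 F (id2 C f) = id2 D (F1 F f)"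
    and F1_comp1: "\<lbrakk>f \<in> ar1 C; g \<in> ar1 C; t1 C f = s1 C g\<rbrakk>
      \<Longrightarrow> F1 F (g \<odot>\<^bsub>C\<^esub> f) = F1 F g \<odot>\<^bsub>D\<^esub> F1 F f"
    and F2_vcomp: "\<lbrakk>a \<in> ar2 C; b \<in> ar2 C; t2 C a = s2 C b\<rbrakk>
      \<Longrightarrow> F2 F (b \<bullet>\<^bsub>C\<^esub> a) = F2 F b \<bullet>\<^bsub>D\<^esub> F2 F a"
    and F2_hcomp: "\<lbrakk>a \<in> ar2 C; b \<in> ar2 C; t1 C (s2 C a) = s1 C (s2 C b)\<rbrakk>
      \<Longrightarrow> F2 F (b \<star>\<^bsub>C\<^esub> a) = F2 F b \<star>\<^bsub>D\<^esub> F2 F a"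

definition id_twofun :: "('o, 'm, 'n) twocat \<Rightarrow> ('o, 'm, 'n, 'o, 'm, 'n) twofun" where
  "id_twofun C = \<lparr>F0 = (\<lambda>x\<in>obj C. x), F1 = (\<lambda>f\<in>ar1 C. f), F2 = (\<lambda>a\<in>ar2 C. a)\<rparr>"

definition comp_twofun ::
  "('o, 'm, 'n) twocat \<Rightarrow> ('p, 'q, 'r, 'x, 'y, 'z) twofun \<Rightarrow> ('o, 'm, 'n, 'p, 'q, 'r) twofun
    \<Rightarrow> ('o, 'm, 'n, 'x, 'y, 'z) twofun" where
  "comp_twofun C G F =
     \<lparr>F0 = (\<lambda>x\<in>obj C. F0 G (F0 F x)),
      F1 = (\<lambda>f\<in>ar1 C. F1 G (F1 F f)),
      F2 = (\<lambda>a\<in>ar2 C. F2 G (F2 F a))\<rparr>"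

definition two_cat_iso ::
  "('o, 'm, 'n) twocat \<Rightarrow> ('p, 'q, 'r) twocat \<Rightarrow> ('o, 'm, 'n, 'p, 'q, 'r) twofun \<Rightarrow> bool" where
  "two_cat_iso A B \<Theta> \<longleftrightarrow>
     two_category A \<and> two_category B \<and> two_functor A B \<Theta> \<and>
     (\<exists>\<Theta>'. two_functor B A \<Theta>' \<and>
        comp_twofun A \<Theta>' \<Theta> = id_twofun A \<and> comp_twofun B \<Theta> \<Theta>' = id_twofun B)"


section \<open>Weak transformations and modifications\<close>

datatype weakness = Strict | Pseudo | Lax | Colax

record ('o, 'm, 'n, 'p, 'q, 'r) trans =
  tsrc :: "('o, 'm, 'n, 'p, 'q, 'r) twofun"
  ttgt :: "('o, 'm, 'n, 'p, 'q, 'r) twofun"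
  tob :: "'o \<Rightarrow> 'q"
  tar :: "'m \<Rightarrow> 'r"

text \<open>
  For \<open>\<phi>\<close> from \<open>F\<close> to \<open>G\<close> and \<open>f\<close> from \<open>X\<close> to \<open>Y\<close>, the 2-cell component of a lax
  transformation goes from \<open>G f \<odot> \<phi> X\<close> to \<open>\<phi> Y \<odot> F f\<close>.
\<close>

definition lax_natural ::
  "('o, 'm, 'n) twocat \<Rightarrow> ('p, 'q, 'r) twocat \<Rightarrow> ('o, 'm, 'n, 'p, 'q, 'r) trans \<Rightarrow> bool" where
  "lax_natural S C \<phi> \<longleftrightarrow> (let F = tsrc \<phi>; G = ttgt \<phi> in
     (\<forall>f\<in>ar1 S. tar \<phi> f \<in> ar2 C \<and>
        s2 C (tar \<phi> f) = F1 G f \<odot>\<^bsub>C\<^esub> tob \<phi> (s1 S f) \<and>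
        t2 C (tar \<phi> f) = tob \<phi> (t1 S f) \<odot>\<^bsub>C\<^esub> F1 F f) \<and>
     (\<forall>x\<in>obj S. tar \<phi> (id1 S x) = id2 C (tob \<phi> x)) \<and>
     (\<forall>f\<in>ar1 S. \<forall>g\<in>ar1 S. t1 S f = s1 S g \<longrightarrow>
        tar \<phi> (g \<odot>\<^bsub>S\<^esub> f) =
          (tar \<phi> g \<star>\<^bsub>C\<^esub> id2 C (F1 F f)) \<bullet>\<^bsub>C\<^esub> (id2 C (F1 G g) \<star>\<^bsub>C\<^esub> tar \<phi> f)) \<and>
     (\<forall>a\<in>ar2 S.
        (id2 C (tob \<phi> (t1 S (s2 S a))) \<star>\<^bsub>C\<^esub> F2 F a) \<bullet>\<^bsub>C\<^esub> tar \<phi> (s2 S a) =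
          tar \<phi> (t2 S a) \<bullet>\<^bsub>C\<^esub> (F2 G a \<star>\<^bsub>C\<^esub> id2 C (tob \<phi> (s1 S (s2 S a))))))"

definition colax_natural ::
  "('o, 'm, 'n) twocat \<Rightarrow> ('p, 'q, 'r) twocat \<Rightarrow> ('o, 'm, 'n, 'p, 'q, 'r) trans \<Rightarrow> bool" where
  "colax_natural S C \<phi> \<longleftrightarrow> (let F = tsrc \<phi>; G = ttgt \<phi> in
     (\<forall>f\<in>ar1 S. tar \<phi> f \<in> ar2 C \<and>
        s2 C (tar \<phi> f) = tob \<phi> (t1 S f) \<odot>\<^bsub>C\<^esub> F1 F f \<and>
        t2 C (tar \<phi> f) = F1 G f \<odot>\<^bsub>C\<^esub> tob \<phi> (s1 S f)) \<and>
     (\<forall>x\<in>obj S. tar \<phi> (id1 S x) = id2 C (tob \<phi> x)) \<and>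
     (\<forall>f\<in>ar1 S. \<forall>g\<in>ar1 S. t1 S f = s1 S g \<longrightarrow>
        tar \<phi> (g \<odot>\<^bsub>S\<^esub> f) =
          (id2 C (F1 G g) \<star>\<^bsub>C\<^esub> tar \<phi> f) \<bullet>\<^bsub>C\<^esub> (tar \<phi> g \<star>\<^bsub>C\<^esub> id2 C (F1 F f))) \<and>
     (\<forall>a\<in>ar2 S.
        (F2 G a \<star>\<^bsub>C\<^esub> id2 C (tob \<phi> (s1 S (s2 S a)))) \<bullet>\<^bsub>C\<^esub> tar \<phi> (s2 S a) =
          tar \<phi> (t2 S a) \<bullet>\<^bsub>C\<^esub> (id2 C (tob \<phi> (t1 S (s2 S a))) \<star>\<^bsub>C\<^esub> F2 F a)))"

text \<open>Pseudonatural and 2-natural transformations are lax ones whose 2-cell components are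
  invertible, respectively identities.\<close>

definition w_natural ::
  "weakness \<Rightarrow> ('o, 'm, 'n) twocat \<Rightarrow> ('p, 'q, 'r) twocat
    \<Rightarrow> ('o, 'm, 'n, 'p, 'q, 'r) trans \<Rightarrow> bool" where
  "w_natural w S C \<phi> \<longleftrightarrow>
     two_functor S C (tsrc \<phi>) \<and> two_functor S C (ttgt \<phi>) \<and>
     tob \<phi> \<in> extensional (obj S) \<and> tar \<phi> \<in> extensional (ar1 S) \<and>
     (\<forall>x\<in>obj S. tob \<phi> x \<in> ar1 C \<and>
        s1 C (tob \<phi> x) = F0 (tsrc \<phi>) x \<and> t1 C (tob \<phi> x) = F0 (ttgt \<phi>) x) \<and>
     (case w of
        Strict \<Rightarrow> lax_natural S C \<phi> \<and> (\<forall>f\<in>ar1 S. is_identity2 C (tar \<phi> f))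
      | Pseudo \<Rightarrow> lax_natural S C \<phi> \<and> (\<forall>f\<in>ar1 S. is_invertible2 C (tar \<phi> f))
      | Lax \<Rightarrow> lax_natural S C \<phi>
      | Colax \<Rightarrow> colax_natural S C \<phi>)"

definition id_trans ::
  "('o, 'm, 'n) twocat \<Rightarrow> ('p, 'q, 'r) twocat \<Rightarrow> ('o, 'm, 'n, 'p, 'q, 'r) twofun
    \<Rightarrow> ('o, 'm, 'n, 'p, 'q, 'r) trans" where
  "id_trans S C F =
     \<lparr>tsrc = F, ttgt = F, tob = (\<lambda>x\<in>obj S. id1 C (F0 F x)), tar = (\<lambda>f\<in>ar1 S. id2 C (F1 F f))\<rparr>"

definition comp_trans ::
  "weakness \<Rightarrow> ('o, 'm, 'n) twocat \<Rightarrow> ('p, 'q, 'r) twocat \<Rightarrow> ('o, 'm, 'n, 'p, 'q, 'r) trans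
    \<Rightarrow> ('o, 'm, 'n, 'p, 'q, 'r) trans \<Rightarrow> ('o, 'm, 'n, 'p, 'q, 'r) trans" where
  "comp_trans w S C \<psi> \<phi> =
     \<lparr>tsrc = tsrc \<phi>, ttgt = ttgt \<psi>,
      tob = (\<lambda>x\<in>obj S. tob \<psi> x \<odot>\<^bsub>C\<^esub> tob \<phi> x),
      tar = (\<lambda>f\<in>ar1 S.
        if w = Colax
        then (tar \<psi> f \<star>\<^bsub>C\<^esub> id2 C (tob \<phi> (s1 S f))) \<bullet>\<^bsub>C\<^esub> (id2 C (tob \<psi> (t1 S f)) \<star>\<^bsub>C\<^esub> tar \<phi> f)
        else (id2 C (tob \<psi> (t1 S f)) \<star>\<^bsub>C\<^esub> tar \<phi> f) \<bullet>\<^bsub>C\<^esub> (tar \<psi> f \<star>\<^bsub>C\<^esub> id2 C (tob \<phi> (s1 S f))))\<rparr>"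

record ('o, 'm, 'n, 'p, 'q, 'r) modif =
  msrc :: "('o, 'm, 'n, 'p, 'q, 'r) trans"
  mtgt :: "('o, 'm, 'n, 'p, 'q, 'r) trans"
  mob :: "'o \<Rightarrow> 'r"

definition modification ::
  "weakness \<Rightarrow> ('o, 'm, 'n) twocat \<Rightarrow> ('p, 'q, 'r) twocat
    \<Rightarrow> ('o, 'm, 'n, 'p, 'q, 'r) modif \<Rightarrow> bool" where
  "modification w S C \<mu> \<longleftrightarrow> (let \<phi> = msrc \<mu>; \<psi> = mtgt \<mu>; F = tsrc \<phi>; G = ttgt \<phi> in
     w_natural w S C \<phi> \<and> w_natural w S C \<psi> \<and> tsrc \<psi> = F \<and> ttgt \<psi> = G \<and>
     mob \<mu> \<in> extensional (obj S) \<and>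
     (\<forall>x\<in>obj S. mob \<mu> x \<in> ar2 C \<and> s2 C (mob \<mu> x) = tob \<phi> x \<and> t2 C (mob \<mu> x) = tob \<psi> x) \<and>
     (\<forall>f\<in>ar1 S.
        if w = Colax
        then (id2 C (F1 G f) \<star>\<^bsub>C\<^esub> mob \<mu> (s1 S f)) \<bullet>\<^bsub>C\<^esub> tar \<phi> f =
               tar \<psi> f \<bullet>\<^bsub>C\<^esub> (mob \<mu> (t1 S f) \<star>\<^bsub>C\<^esub> id2 C (F1 F f))
        else (mob \<mu> (t1 S f) \<star>\<^bsub>C\<^esub> id2 C (F1 F f)) \<bullet>\<^bsub>C\<^esub> tar \<phi> f =
               tar \<psi> f \<bullet>\<^bsub>C\<^esub> (id2 C (F1 G f) \<star>\<^bsub>C\<^esub> mob \<mu> (s1 S f))))"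

text \<open>The locally full sub-2-category, of the 2-category of 2-functors, \<open>w\<close>-natural
  transformations and modifications, on the 2-functors satisfying \<open>P\<close> and the transformations
  satisfying \<open>Q\<close>.\<close>

definition functor_twocat ::
  "weakness \<Rightarrow> ('o, 'm, 'n) twocat \<Rightarrow> ('p, 'q, 'r) twocat
    \<Rightarrow> (('o, 'm, 'n, 'p, 'q, 'r) twofun \<Rightarrow> bool) \<Rightarrow> (('o, 'm, 'n, 'p, 'q, 'r) trans \<Rightarrow> bool)
    \<Rightarrow> (('o, 'm, 'n, 'p, 'q, 'r) twofun, ('o, 'm, 'n, 'p, 'q, 'r) trans,
        ('o, 'm, 'n, 'p, 'q, 'r) modif) twocat" where
  "functor_twocat w S C P Q = (let
      Fs = {F. two_functor S C F \<and> P F};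
      Ts = {\<phi>. w_natural w S C \<phi> \<and> tsrc \<phi> \<in> Fs \<and> ttgt \<phi> \<in> Fs \<and> Q \<phi>} in
     \<lparr>obj = Fs,
      ar1 = Ts, s1 = tsrc, t1 = ttgt, id1 = id_trans S C, comp1 = comp_trans w S C,
      ar2 = {\<mu>. modification w S C \<mu> \<and> msrc \<mu> \<in> Ts \<and> mtgt \<mu> \<in> Ts},
      s2 = msrc, t2 = mtgt,
      id2 = (\<lambda>\<phi>. \<lparr>msrc = \<phi>, mtgt = \<phi>, mob = (\<lambda>x\<in>obj S. id2 C (tob \<phi> x))\<rparr>),
      vcomp = (\<lambda>\<nu> \<mu>. \<lparr>msrc = msrc \<mu>, mtgt = mtgt \<nu>,
                      mob = (\<lambda>x\<in>obj S. mob \<nu> x \<bullet>\<^bsub>C\<^esub> mob \<mu> x)\<rparr>),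
      hcomp = (\<lambda>\<nu> \<mu>. \<lparr>msrc = comp_trans w S C (msrc \<nu>) (msrc \<mu>),
                      mtgt = comp_trans w S C (mtgt \<nu>) (mtgt \<mu>),
                      mob = (\<lambda>x\<in>obj S. mob \<nu> x \<star>\<^bsub>C\<^esub> mob \<mu> x)\<rparr>)\<rparr>)"

text \<open>Postcomposition with a 2-functor \<open>H\<close>, as a 2-functor on a 2-category \<open>A\<close> of 2-functors
  out of \<open>S\<close>, and the components \<open>\<alpha> M\<close> of postcomposition with a transformation \<open>\<alpha>\<close>.\<close>

definition postwhisker_trans ::
  "('o, 'm, 'n) twocat \<Rightarrow> ('p, 'q, 'r, 'x, 'y, 'z) twofun \<Rightarrow> ('o, 'm, 'n, 'p, 'q, 'r) trans
    \<Rightarrow> ('o, 'm, 'n, 'x, 'y, 'z) trans" where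
  "postwhisker_trans S H \<phi> =
     \<lparr>tsrc = comp_twofun S H (tsrc \<phi>), ttgt = comp_twofun S H (ttgt \<phi>),
      tob = (\<lambda>x\<in>obj S. F1 H (tob \<phi> x)), tar = (\<lambda>f\<in>ar1 S. F2 H (tar \<phi> f))\<rparr>"

definition postwhisker_modif ::
  "('o, 'm, 'n) twocat \<Rightarrow> ('p, 'q, 'r, 'x, 'y, 'z) twofun \<Rightarrow> ('o, 'm, 'n, 'p, 'q, 'r) modif
    \<Rightarrow> ('o, 'm, 'n, 'x, 'y, 'z) modif" where
  "postwhisker_modif S H \<mu> =
     \<lparr>msrc = postwhisker_trans S H (msrc \<mu>), mtgt = postwhisker_trans S H (mtgt \<mu>),
      mob = (\<lambda>x\<in>obj S. F2 H (mob \<mu> x))\<rparr>"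

definition postcomp ::
  "(('o, 'm, 'n, 'p, 'q, 'r) twofun, ('o, 'm, 'n, 'p, 'q, 'r) trans,
      ('o, 'm, 'n, 'p, 'q, 'r) modif) twocat
    \<Rightarrow> ('o, 'm, 'n) twocat \<Rightarrow> ('p, 'q, 'r, 'x, 'y, 'z) twofun
    \<Rightarrow> (('o, 'm, 'n, 'p, 'q, 'r) twofun, ('o, 'm, 'n, 'p, 'q, 'r) trans,
        ('o, 'm, 'n, 'p, 'q, 'r) modif,
        ('o, 'm, 'n, 'x, 'y, 'z) twofun, ('o, 'm, 'n, 'x, 'y, 'z) trans,
        ('o, 'm, 'n, 'x, 'y, 'z) modif) twofun" where
  "postcomp A S H =
     \<lparr>F0 = (\<lambda>M\<in>obj A. comp_twofun S H M),
      F1 = (\<lambda>\<phi>\<in>ar1 A. postwhisker_trans S H \<phi>),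
      F2 = (\<lambda>\<mu>\<in>ar2 A. postwhisker_modif S H \<mu>)\<rparr>"

definition prewhisker_trans ::
  "('o, 'm, 'n) twocat \<Rightarrow> ('p, 'q, 'r, 'x, 'y, 'z) trans \<Rightarrow> ('o, 'm, 'n, 'p, 'q, 'r) twofun
    \<Rightarrow> ('o, 'm, 'n, 'x, 'y, 'z) trans" where
  "prewhisker_trans S \<alpha> M =
     \<lparr>tsrc = comp_twofun S (tsrc \<alpha>) M, ttgt = comp_twofun S (ttgt \<alpha>) M,
      tob = (\<lambda>x\<in>obj S. tob \<alpha> (F0 M x)), tar = (\<lambda>f\<in>ar1 S. tar \<alpha> (F1 M f))\<rparr>"


section \<open>2-sketches\<close>

text \<open>A weight is a 2-functor from its index 2-category to the 2-category of categories.\<close>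

record ('jo, 'jm, 'jn, 'wo, 'wm) weight =
  widx :: "('jo, 'jm, 'jn) twocat"
  wob :: "'jo \<Rightarrow> ('wo, 'wm) cat"
  wfun :: "'jm \<Rightarrow> ('wo, 'wm, 'wo, 'wm) func"
  wnat :: "'jn \<Rightarrow> 'wo \<Rightarrow> 'wm"

locale is_weight =
  fixes W :: "('jo, 'jm, 'jn, 'wo, 'wm) weight"
  assumes idx: "two_category (widx W)"
    and wob_ext: "wob W \<in> extensional (obj (widx W))"
    and wfun_ext: "wfun W \<in> extensional (ar1 (widx W))"
    and wnat_ext: "wnat W \<in> extensional (ar2 (widx W))"
    and wob_category: "j \<in> obj (widx W) \<Longrightarrow> category (wob W j)"
    and wfun_functor: "f \<in> ar1 (widx W) \<Longrightarrow>
      cat_functor (wob W (s1 (widx W) f)) (wob W (t1 (widx W) f)) (wfun W f)"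
    and wfun_id: "j \<in> obj (widx W) \<Longrightarrow> wfun W (id1 (widx W) j) = id_func (wob W j)"
    and wfun_comp: "\<lbrakk>f \<in> ar1 (widx W); g \<in> ar1 (widx W); t1 (widx W) f = s1 (widx W) g\<rbrakk> \<Longrightarrow>
      wfun W (g \<odot>\<^bsub>widx W\<^esub> f) = comp_func (wob W (s1 (widx W) f)) (wfun W g) (wfun W f)"
    and wnat_nat: "a \<in> ar2 (widx W) \<Longrightarrow>
      nat_trans (wob W (s1 (widx W) (s2 (widx W) a))) (wob W (t1 (widx W) (s2 (widx W) a)))
        (wfun W (s2 (widx W) a)) (wfun W (t2 (widx W) a)) (wnat W a)"
    and wnat_id: "\<lbrakk>f \<in> ar1 (widx W); y \<in> Ob (wob W (s1 (widx W) f))\<rbrakk> \<Longrightarrow>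
      wnat W (id2 (widx W) f) y = Id (wob W (t1 (widx W) f)) (fob (wfun W f) y)"
    and wnat_vcomp: "\<lbrakk>a \<in> ar2 (widx W); b \<in> ar2 (widx W); t2 (widx W) a = s2 (widx W) b;
        y \<in> Ob (wob W (s1 (widx W) (s2 (widx W) a)))\<rbrakk> \<Longrightarrow>
      wnat W (b \<bullet>\<^bsub>widx W\<^esub> a) y = wnat W b y \<cdot>\<^bsub>wob W (t1 (widx W) (s2 (widx W) a))\<^esub> wnat W a y"
    and wnat_hcomp: "\<lbrakk>a \<in> ar2 (widx W); b \<in> ar2 (widx W);
        t1 (widx W) (s2 (widx W) a) = s1 (widx W) (s2 (widx W) b);
        y \<in> Ob (wob W (s1 (widx W) (s2 (widx W) a)))\<rbrakk> \<Longrightarrow>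
      wnat W (b \<star>\<^bsub>widx W\<^esub> a) y =
        wnat W b (fob (wfun W (t2 (widx W) a)) y)
          \<cdot>\<^bsub>wob W (t1 (widx W) (s2 (widx W) b))\<^esub> far (wfun W (s2 (widx W) b)) (wnat W a y)"

record ('jo, 'jm, 'jn, 'wo, 'wm, 'o, 'm, 'n) cone =
  cweight :: "('jo, 'jm, 'jn, 'wo, 'wm) weight"
  cdiag :: "('jo, 'jm, 'jn, 'o, 'm, 'n) twofun"
  capex :: "'o"
  cleg :: "'jo \<Rightarrow> ('wo, 'wm, 'm, 'n) func"

definition proj :: "('jo, 'jm, 'jn, 'wo, 'wm, 'o, 'm, 'n) cone \<Rightarrow> 'jo \<Rightarrow> 'wo \<Rightarrow> 'm" where
  "proj \<gamma> j y = fob (cleg \<gamma> j) y"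

text \<open>The three naturality clauses say that the legs form a 2-natural transformation from the
  weight to the 2-functor sending \<open>j\<close> to \<open>hom_cat S X (D j)\<close>.\<close>

definition is_cone ::
  "('o, 'm, 'n) twocat \<Rightarrow> ('jo, 'jm, 'jn, 'wo, 'wm, 'o, 'm, 'n) cone \<Rightarrow> bool" where
  "is_cone S \<gamma> \<longleftrightarrow> (let W = cweight \<gamma>; J = widx W; D = cdiag \<gamma>; X = capex \<gamma> in
     is_weight W \<and> two_functor J S D \<and> X \<in> obj S \<and>
     cleg \<gamma> \<in> extensional (obj J) \<and>
     (\<forall>j\<in>obj J. cat_functor (wob W j) (hom_cat S X (F0 D j)) (cleg \<gamma> j)) \<and>
     (\<forall>f\<in>ar1 J. \<forall>y\<in>Ob (wob W (s1 J f)).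
        F1 D f \<odot>\<^bsub>S\<^esub> fob (cleg \<gamma> (s1 J f)) y = fob (cleg \<gamma> (t1 J f)) (fob (wfun W f) y)) \<and>
     (\<forall>f\<in>ar1 J. \<forall>u\<in>Ar (wob W (s1 J f)).
        id2 S (F1 D f) \<star>\<^bsub>S\<^esub> far (cleg \<gamma> (s1 J f)) u = far (cleg \<gamma> (t1 J f)) (far (wfun W f) u)) \<and>
     (\<forall>a\<in>ar2 J. \<forall>y\<in>Ob (wob W (s1 J (s2 J a))).
        F2 D a \<star>\<^bsub>S\<^esub> id2 S (fob (cleg \<gamma> (s1 J (s2 J a))) y) =
          far (cleg \<gamma> (t1 J (s2 J a))) (wnat W a y)))"

definition image_legs ::
  "('o, 'm, 'n, 'p, 'q, 'r) twofun \<Rightarrow> 'jo set \<Rightarrow> ('jo \<Rightarrow> ('wo, 'wm) cat)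
    \<Rightarrow> ('jo \<Rightarrow> ('wo, 'wm, 'm, 'n) func) \<Rightarrow> 'jo \<Rightarrow> ('wo, 'wm, 'q, 'r) func" where
  "image_legs F Js A l =
     (\<lambda>j\<in>Js. \<lparr>fob = (\<lambda>y\<in>Ob (A j). F1 F (fob (l j) y)), far = (\<lambda>u\<in>Ar (A j). F2 F (far (l j) u))\<rparr>)"

definition image_cone ::
  "('o, 'm, 'n, 'p, 'q, 'r) twofun \<Rightarrow> ('jo, 'jm, 'jn, 'wo, 'wm, 'o, 'm, 'n) cone
    \<Rightarrow> ('jo, 'jm, 'jn, 'wo, 'wm, 'p, 'q, 'r) cone" where
  "image_cone F \<gamma> = (let W = cweight \<gamma> in
     \<lparr>cweight = W, cdiag = comp_twofun (widx W) F (cdiag \<gamma>), capex = F0 F (capex \<gamma>),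
      cleg = image_legs F (obj (widx W)) (wob W) (cleg \<gamma>)\<rparr>)"

record ('jo, 'jm, 'jn, 'wo, 'wm, 'o, 'm, 'n) sketch =
  base :: "('o, 'm, 'n) twocat"
  cones :: "('jo, 'jm, 'jn, 'wo, 'wm, 'o, 'm, 'n) cone set"

definition is_sketch :: "('jo, 'jm, 'jn, 'wo, 'wm, 'o, 'm, 'n) sketch \<Rightarrow> bool" where
  "is_sketch S \<longleftrightarrow> two_category (base S) \<and> (\<forall>\<gamma>\<in>cones S. is_cone (base S) \<gamma>)"

definition weights ::
  "('jo, 'jm, 'jn, 'wo, 'wm, 'o, 'm, 'n) sketch \<Rightarrow> ('jo, 'jm, 'jn, 'wo, 'wm) weight set" where
  "weights S = cweight ` cones S"

definition is_model ::
  "('jo, 'jm, 'jn, 'wo, 'wm, 'o, 'm, 'n) sketch \<Rightarrow> ('jo, 'jm, 'jn, 'wo, 'wm, 'p, 'q, 'r) sketch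
    \<Rightarrow> ('o, 'm, 'n, 'p, 'q, 'r) twofun \<Rightarrow> bool" where
  "is_model S C F \<longleftrightarrow>
     two_functor (base S) (base C) F \<and> (\<forall>\<gamma>\<in>cones S. image_cone F \<gamma> \<in> cones C)"


section \<open>Flexible weights and cleavages\<close>

definition el_ob :: "('jo, 'jm, 'jn, 'wo, 'wm) weight \<Rightarrow> ('jo \<times> 'wo) set" where
  "el_ob W = {(j, y). j \<in> obj (widx W) \<and> y \<in> Ob (wob W j)}"

definition el_arrow ::
  "('jo, 'jm, 'jn, 'wo, 'wm) weight \<Rightarrow> 'jo \<times> 'wo \<Rightarrow> 'jo \<times> 'wo \<Rightarrow> 'jm \<Rightarrow> bool" where
  "el_arrow W A B f \<longleftrightarrow> A \<in> el_ob W \<and> B \<in> el_ob W \<and>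
     f \<in> ar1 (widx W) \<and> s1 (widx W) f = fst A \<and> t1 (widx W) f = fst B \<and>
     fob (wfun W f) (snd A) = snd B"

definition el_components :: "('jo, 'jm, 'jn, 'wo, 'wm) weight \<Rightarrow> ('jo \<times> 'wo) set set" where
  "el_components W =
     {{B \<in> el_ob W. equivclp (\<lambda>A' B'. \<exists>f. el_arrow W A' B' f) A B} | A. A \<in> el_ob W}"

definition naturally_weakly_initial ::
  "('jo, 'jm, 'jn, 'wo, 'wm) weight \<Rightarrow> ('jo \<times> 'wo) set \<Rightarrow> 'jo \<times> 'wo \<Rightarrow> ('jo \<times> 'wo \<Rightarrow> 'jm) \<Rightarrow> bool"
  where
  "naturally_weakly_initial W K I i \<longleftrightarrow>
     I \<in> K \<and> (\<forall>A\<in>K. el_arrow W I A (i A)) \<and>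
     (\<forall>A\<in>K. \<forall>B\<in>K. \<forall>f. el_arrow W A B f \<longrightarrow> f \<odot>\<^bsub>widx W\<^esub> i A = i B)"

text \<open>Flexibility, in the form of which a cleavage is a choice of witnesses: the components are
  those of the category of elements of the set-valued functor underlying the weight.\<close>

definition flexible :: "('jo, 'jm, 'jn, 'wo, 'wm) weight \<Rightarrow> bool" where
  "flexible W \<longleftrightarrow> is_weight W \<and> (\<forall>K\<in>el_components W. \<exists>I i. naturally_weakly_initial W K I i)"

type_synonym ('jo, 'jm, 'wo) cleavage =
  "('jo \<times> 'wo) set \<Rightarrow> ('jo \<times> 'wo) \<times> ('jo \<times> 'wo \<Rightarrow> 'jm)"

definition is_cleavage ::
  "('jo, 'jm, 'jn, 'wo, 'wm) weight \<Rightarrow> ('jo, 'jm, 'wo) cleavage \<Rightarrow> bool" where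
  "is_cleavage W \<Omega> \<longleftrightarrow>
     (\<forall>K\<in>el_components W. naturally_weakly_initial W K (fst (\<Omega> K)) (snd (\<Omega> K)))"

definition chosen ::
  "('jo, 'jm, 'jn, 'wo, 'wm) weight \<Rightarrow> ('jo, 'jm, 'wo) cleavage \<Rightarrow> ('jo \<times> 'wo) set" where
  "chosen W \<Omega> = (\<lambda>K. fst (\<Omega> K)) ` el_components W"

text \<open>A cloven sketch carries one cleavage per weight, not one per cone.\<close>

definition cloven_flexible_sketch ::
  "('jo, 'jm, 'jn, 'wo, 'wm, 'o, 'm, 'n) sketch
    \<Rightarrow> (('jo, 'jm, 'jn, 'wo, 'wm) weight \<Rightarrow> ('jo, 'jm, 'wo) cleavage) \<Rightarrow> bool" where
  "cloven_flexible_sketch S \<Omega> \<longleftrightarrow>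
     is_sketch S \<and> (\<forall>W\<in>weights S. flexible W \<and> is_cleavage W (\<Omega> W))"

definition Mod ::
  "weakness \<Rightarrow> ('jo, 'jm, 'jn, 'wo, 'wm, 'o, 'm, 'n) sketch
    \<Rightarrow> (('jo, 'jm, 'jn, 'wo, 'wm) weight \<Rightarrow> ('jo, 'jm, 'wo) cleavage)
    \<Rightarrow> ('jo, 'jm, 'jn, 'wo, 'wm, 'p, 'q, 'r) sketch
    \<Rightarrow> (('o, 'm, 'n, 'p, 'q, 'r) twofun, ('o, 'm, 'n, 'p, 'q, 'r) trans,
        ('o, 'm, 'n, 'p, 'q, 'r) modif) twocat" where
  "Mod w S \<Omega> C = functor_twocat w (base S) (base C) (is_model S C)
     (\<lambda>\<phi>. \<forall>\<gamma>\<in>cones S. \<forall>(j, y)\<in>chosen (cweight \<gamma>) (\<Omega> (cweight \<gamma>)).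
        is_identity2 (base C) (tar \<phi> (proj \<gamma> j y)))"


section \<open>\<open>\<F>\<close>-categories and \<open>\<F>\<close>-sketches\<close>

record ('o, 'm, 'n) fcat =
  loose :: "('o, 'm, 'n) twocat"
  tight :: "'m set"

definition is_fcat :: "('o, 'm, 'n) fcat \<Rightarrow> bool" where
  "is_fcat C \<longleftrightarrow> two_category (loose C) \<and> tight C \<subseteq> ar1 (loose C) \<and>
     id1 (loose C) ` obj (loose C) \<subseteq> tight C \<and>
     (\<forall>f\<in>tight C. \<forall>g\<in>tight C. t1 (loose C) f = s1 (loose C) g \<longrightarrow> g \<odot>\<^bsub>loose C\<^esub> f \<in> tight C)"

definition f_functor ::
  "('o, 'm, 'n) fcat \<Rightarrow> ('p, 'q, 'r) fcat \<Rightarrow> ('o, 'm, 'n, 'p, 'q, 'r) twofun \<Rightarrow> bool" where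
  "f_functor C D F \<longleftrightarrow> two_functor (loose C) (loose D) F \<and> (\<forall>f\<in>tight C. F1 F f \<in> tight D)"

definition chordate :: "('o, 'm, 'n) twocat \<Rightarrow> ('o, 'm, 'n) fcat" where
  "chordate K = \<lparr>loose = K, tight = ar1 K\<rparr>"

definition inchordate :: "('o, 'm, 'n) twocat \<Rightarrow> ('o, 'm, 'n) fcat" where
  "inchordate K = \<lparr>loose = K, tight = id1 K ` obj K\<rparr>"

text \<open>Objects of \<open>\<F>\<close>: full embeddings of a tight part into a loose part.\<close>

record ('to, 'tm, 'lo, 'lm) fobj =
  tpart :: "('to, 'tm) cat"
  lpart :: "('lo, 'lm) cat"
  emb :: "('to, 'tm, 'lo, 'lm) func"

definition is_fobj :: "('to, 'tm, 'lo, 'lm) fobj \<Rightarrow> bool" where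
  "is_fobj A \<longleftrightarrow> category (tpart A) \<and> category (lpart A) \<and>
     cat_functor (tpart A) (lpart A) (emb A) \<and> inj_on (fob (emb A)) (Ob (tpart A)) \<and>
     (\<forall>x\<in>Ob (tpart A). \<forall>y\<in>Ob (tpart A).
        bij_betw (far (emb A))
          {a \<in> Ar (tpart A). Dom (tpart A) a = x \<and> Cod (tpart A) a = y}
          {a \<in> Ar (lpart A). Dom (lpart A) a = fob (emb A) x \<and> Cod (lpart A) a = fob (emb A) y})"

text \<open>The functors between loose parts that restrict to the tight parts; the restriction is
  unique because the embedding of the codomain is injective.\<close>

definition tight_functor ::
  "('to, 'tm, 'lo, 'lm) fobj \<Rightarrow> ('to', 'tm', 'lo', 'lm') fobj \<Rightarrow> ('lo, 'lm, 'lo', 'lm') func \<Rightarrow> bool"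
  where
  "tight_functor A B F \<longleftrightarrow> cat_functor (lpart A) (lpart B) F \<and>
     (\<exists>G. cat_functor (tpart A) (tpart B) G \<and>
        comp_func (tpart A) (emb B) G = comp_func (tpart A) F (emb A))"

definition full_inclusion :: "('o, 'a) cat \<Rightarrow> 'o set \<Rightarrow> ('o, 'a, 'o, 'a) fobj" where
  "full_inclusion A P =
     (let B = A\<lparr>Ob := {x \<in> Ob A. x \<in> P}, Ar := {a \<in> Ar A. Dom A a \<in> P \<and> Cod A a \<in> P}\<rparr>
      in \<lparr>tpart = B, lpart = A, emb = id_func B\<rparr>)"

definition identity_fobj :: "('o, 'a) cat \<Rightarrow> ('o, 'a, 'o, 'a) fobj" where
  "identity_fobj A = \<lparr>tpart = A, lpart = A, emb = id_func A\<rparr>"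

definition fhom :: "('o, 'm, 'n) fcat \<Rightarrow> 'o \<Rightarrow> 'o \<Rightarrow> ('m, 'n, 'm, 'n) fobj" where
  "fhom C X Y = full_inclusion (hom_cat (loose C) X Y) (tight C)"

record ('jo, 'jm, 'jn, 'to, 'tm, 'wo, 'wm) fweight =
  fwidx :: "('jo, 'jm, 'jn) fcat"
  fwob :: "'jo \<Rightarrow> ('to, 'tm, 'wo, 'wm) fobj"
  fwfun :: "'jm \<Rightarrow> ('wo, 'wm, 'wo, 'wm) func"
  fwnat :: "'jn \<Rightarrow> 'wo \<Rightarrow> 'wm"

definition loose_weight ::
  "('jo, 'jm, 'jn, 'to, 'tm, 'wo, 'wm) fweight \<Rightarrow> ('jo, 'jm, 'jn, 'wo, 'wm) weight" where
  "loose_weight W =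
     \<lparr>widx = loose (fwidx W), wob = (\<lambda>j\<in>obj (loose (fwidx W)). lpart (fwob W j)),
      wfun = fwfun W, wnat = fwnat W\<rparr>"

definition is_fweight :: "('jo, 'jm, 'jn, 'to, 'tm, 'wo, 'wm) fweight \<Rightarrow> bool" where
  "is_fweight W \<longleftrightarrow> is_fcat (fwidx W) \<and> is_weight (loose_weight W) \<and>
     fwob W \<in> extensional (obj (loose (fwidx W))) \<and>
     (\<forall>j\<in>obj (loose (fwidx W)). is_fobj (fwob W j)) \<and>
     (\<forall>f\<in>tight (fwidx W).
        tight_functor (fwob W (s1 (loose (fwidx W)) f)) (fwob W (t1 (loose (fwidx W)) f))
          (fwfun W f))"

record ('jo, 'jm, 'jn, 'to, 'tm, 'wo, 'wm, 'o, 'm, 'n) fcone =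
  fcweight :: "('jo, 'jm, 'jn, 'to, 'tm, 'wo, 'wm) fweight"
  fcdiag :: "('jo, 'jm, 'jn, 'o, 'm, 'n) twofun"
  fcapex :: "'o"
  fcleg :: "'jo \<Rightarrow> ('wo, 'wm, 'm, 'n) func"

definition loose_cone ::
  "('jo, 'jm, 'jn, 'to, 'tm, 'wo, 'wm, 'o, 'm, 'n) fcone
    \<Rightarrow> ('jo, 'jm, 'jn, 'wo, 'wm, 'o, 'm, 'n) cone" where
  "loose_cone \<gamma> =
     \<lparr>cweight = loose_weight (fcweight \<gamma>), cdiag = fcdiag \<gamma>, capex = fcapex \<gamma>, cleg = fcleg \<gamma>\<rparr>"

definition is_fcone ::
  "('o, 'm, 'n) fcat \<Rightarrow> ('jo, 'jm, 'jn, 'to, 'tm, 'wo, 'wm, 'o, 'm, 'n) fcone \<Rightarrow> bool" where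
  "is_fcone C \<gamma> \<longleftrightarrow> (let W = fcweight \<gamma>; J = fwidx W; D = fcdiag \<gamma> in
     is_fweight W \<and> f_functor J C D \<and> is_cone (loose C) (loose_cone \<gamma>) \<and>
     (\<forall>j\<in>obj (loose J). tight_functor (fwob W j) (fhom C (fcapex \<gamma>) (F0 D j)) (fcleg \<gamma> j)))"

definition image_fcone ::
  "('o, 'm, 'n, 'p, 'q, 'r) twofun \<Rightarrow> ('jo, 'jm, 'jn, 'to, 'tm, 'wo, 'wm, 'o, 'm, 'n) fcone
    \<Rightarrow> ('jo, 'jm, 'jn, 'to, 'tm, 'wo, 'wm, 'p, 'q, 'r) fcone" where
  "image_fcone F \<gamma> = (let W = fcweight \<gamma>; J = loose (fwidx W) in
     \<lparr>fcweight = W, fcdiag = comp_twofun J F (fcdiag \<gamma>), fcapex = F0 F (fcapex \<gamma>),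
      fcleg = image_legs F (obj J) (\<lambda>j. lpart (fwob W j)) (fcleg \<gamma>)\<rparr>)"

record ('jo, 'jm, 'jn, 'to, 'tm, 'wo, 'wm, 'o, 'm, 'n) fsketch =
  fbase :: "('o, 'm, 'n) fcat"
  fcones :: "('jo, 'jm, 'jn, 'to, 'tm, 'wo, 'wm, 'o, 'm, 'n) fcone set"

definition is_fsketch :: "('jo, 'jm, 'jn, 'to, 'tm, 'wo, 'wm, 'o, 'm, 'n) fsketch \<Rightarrow> bool" where
  "is_fsketch A \<longleftrightarrow> is_fcat (fbase A) \<and> (\<forall>\<gamma>\<in>fcones A. is_fcone (fbase A) \<gamma>)"

text \<open>
  \<open>restricts_to \<delta> \<gamma>\<close>: the \<open>\<F>\<close>-weighted cone \<open>\<gamma>\<close> is the restriction of \<open>\<delta>\<close> along an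
  \<open>\<F>\<close>-functor from the index of \<open>\<gamma>\<close> to that of \<open>\<delta>\<close> and an \<open>\<F>\<close>-natural transformation between
  the weights, both of which are identities on loose parts.  Thus \<open>\<gamma>\<close> has the same components
  as \<open>\<delta>\<close>, and its index and weight have at most as many tight morphisms and objects.
\<close>

definition restricts_to ::
  "('jo, 'jm, 'jn, 'to, 'tm, 'wo, 'wm, 'o, 'm, 'n) fcone
    \<Rightarrow> ('jo, 'jm, 'jn, 'to', 'tm', 'wo, 'wm, 'o, 'm, 'n) fcone \<Rightarrow> bool" where
  "restricts_to \<delta> \<gamma> \<longleftrightarrow>
     loose_cone \<delta> = loose_cone \<gamma> \<and>
     tight (fwidx (fcweight \<gamma>)) \<subseteq> tight (fwidx (fcweight \<delta>)) \<and>
     (\<forall>j\<in>obj (loose (fwidx (fcweight \<gamma>))).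
        tight_functor (fwob (fcweight \<gamma>) j) (fwob (fcweight \<delta>) j)
          (id_func (lpart (fwob (fcweight \<gamma>) j))))"

text \<open>
  A model sends specified cones to specified cones, where a cone counts as specified when it is
  the restriction of one of the listed cones.  Equality of cones would be too strict here: the
  cones of the free \<open>\<F>\<close>-sketch on a cloven 2-sketch are weighted by \<open>induced_weight\<close>, over an
  inchordate index, and those of \<open>chordate_sketch\<close> by \<open>chordate_weight\<close>, over a chordate index,
  so that the former are carried to restrictions of the latter but almost never to the latter
  themselves.
\<close>

definition is_fmodel ::
  "('jo, 'jm, 'jn, 'to, 'tm, 'wo, 'wm, 'o, 'm, 'n) fsketch
    \<Rightarrow> ('jo, 'jm, 'jn, 'to', 'tm', 'wo, 'wm, 'p, 'q, 'r) fsketch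
    \<Rightarrow> ('o, 'm, 'n, 'p, 'q, 'r) twofun \<Rightarrow> bool" where
  "is_fmodel A B F \<longleftrightarrow> f_functor (fbase A) (fbase B) F \<and>
     (\<forall>\<gamma>\<in>fcones A. \<exists>\<delta>\<in>fcones B. restricts_to \<delta> (image_fcone F \<gamma>))"

definition FMod ::
  "weakness \<Rightarrow> ('jo, 'jm, 'jn, 'to, 'tm, 'wo, 'wm, 'o, 'm, 'n) fsketch
    \<Rightarrow> ('jo, 'jm, 'jn, 'to', 'tm', 'wo, 'wm, 'p, 'q, 'r) fsketch
    \<Rightarrow> (('o, 'm, 'n, 'p, 'q, 'r) twofun, ('o, 'm, 'n, 'p, 'q, 'r) trans,
        ('o, 'm, 'n, 'p, 'q, 'r) modif) fcat" where
  "FMod w A B = (let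
      M = functor_twocat w (loose (fbase A)) (loose (fbase B)) (is_fmodel A B)
            (\<lambda>\<phi>. \<forall>f\<in>tight (fbase A). is_identity2 (loose (fbase B)) (tar \<phi> f)) in
     \<lparr>loose = M,
      tight = {\<phi> \<in> ar1 M.
        (\<forall>x\<in>obj (loose (fbase A)). tob \<phi> x \<in> tight (fbase B)) \<and>
        (\<forall>f\<in>ar1 (loose (fbase A)). is_identity2 (loose (fbase B)) (tar \<phi> f))}\<rparr>)"


section \<open>The free and the chordate \<open>\<F>\<close>-sketch\<close>

definition induced_weight ::
  "('jo, 'jm, 'jn, 'wo, 'wm) weight \<Rightarrow> ('jo, 'jm, 'wo) cleavage
    \<Rightarrow> ('jo, 'jm, 'jn, 'wo, 'wm, 'wo, 'wm) fweight" where
  "induced_weight W \<Omega> =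
     \<lparr>fwidx = inchordate (widx W),
      fwob = (\<lambda>j\<in>obj (widx W). full_inclusion (wob W j) {y. (j, y) \<in> chosen W \<Omega>}),
      fwfun = wfun W, fwnat = wnat W\<rparr>"

text \<open>The cones of \<open>S\<close> whose weight underlies a weight in \<open>\<Psi>\<close>, with the choice of that weight.\<close>

definition enhanced_cones ::
  "('jo, 'jm, 'jn, 'wo, 'wm, 'o, 'm, 'n) sketch
    \<Rightarrow> ('jo, 'jm, 'jn, 'to, 'tm, 'wo, 'wm) fweight set
    \<Rightarrow> ('jo, 'jm, 'jn, 'to, 'tm, 'wo, 'wm, 'o, 'm, 'n) fcone set" where
  "enhanced_cones S \<Psi> = {\<gamma>. fcweight \<gamma> \<in> \<Psi> \<and> loose_cone \<gamma> \<in> cones S}"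

inductive_set free_tight ::
  "('jo, 'jm, 'jn, 'wo, 'wm, 'o, 'm, 'n) sketch
    \<Rightarrow> ('jo, 'jm, 'jn, 'to, 'tm, 'wo, 'wm) fweight set \<Rightarrow> 'm set"
  for S and \<Psi> where
    free_id: "x \<in> obj (base S) \<Longrightarrow> id1 (base S) x \<in> free_tight S \<Psi>"
  | free_comp: "\<lbrakk>f \<in> free_tight S \<Psi>; g \<in> free_tight S \<Psi>; t1 (base S) f = s1 (base S) g\<rbrakk>
      \<Longrightarrow> g \<odot>\<^bsub>base S\<^esub> f \<in> free_tight S \<Psi>"
  | free_diag: "\<lbrakk>\<gamma> \<in> enhanced_cones S \<Psi>; f \<in> tight (fwidx (fcweight \<gamma>))\<rbrakk>
      \<Longrightarrow> F1 (fcdiag \<gamma>) f \<in> free_tight S \<Psi>"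
  | free_proj: "\<lbrakk>\<gamma> \<in> enhanced_cones S \<Psi>; j \<in> obj (loose (fwidx (fcweight \<gamma>)));
        y \<in> Ob (tpart (fwob (fcweight \<gamma>) j))\<rbrakk>
      \<Longrightarrow> proj (loose_cone \<gamma>) j (fob (emb (fwob (fcweight \<gamma>) j)) y) \<in> free_tight S \<Psi>"

definition free_fsketch ::
  "('jo, 'jm, 'jn, 'wo, 'wm, 'o, 'm, 'n) sketch
    \<Rightarrow> ('jo, 'jm, 'jn, 'to, 'tm, 'wo, 'wm) fweight set
    \<Rightarrow> ('jo, 'jm, 'jn, 'to, 'tm, 'wo, 'wm, 'o, 'm, 'n) fsketch" where
  "free_fsketch S \<Psi> =
     \<lparr>fbase = \<lparr>loose = base S, tight = free_tight S \<Psi>\<rparr>, fcones = enhanced_cones S \<Psi>\<rparr>"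

definition chordate_weight ::
  "('jo, 'jm, 'jn, 'wo, 'wm) weight \<Rightarrow> ('jo, 'jm, 'jn, 'wo, 'wm, 'wo, 'wm) fweight" where
  "chordate_weight W =
     \<lparr>fwidx = chordate (widx W), fwob = (\<lambda>j\<in>obj (widx W). identity_fobj (wob W j)),
      fwfun = wfun W, fwnat = wnat W\<rparr>"

definition chordate_cone ::
  "('jo, 'jm, 'jn, 'wo, 'wm, 'o, 'm, 'n) cone
    \<Rightarrow> ('jo, 'jm, 'jn, 'wo, 'wm, 'wo, 'wm, 'o, 'm, 'n) fcone" where
  "chordate_cone \<gamma> =
     \<lparr>fcweight = chordate_weight (cweight \<gamma>), fcdiag = cdiag \<gamma>, fcapex = capex \<gamma>,
      fcleg = cleg \<gamma>\<rparr>"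

definition chordate_sketch ::
  "('jo, 'jm, 'jn, 'wo, 'wm, 'o, 'm, 'n) sketch
    \<Rightarrow> ('jo, 'jm, 'jn, 'wo, 'wm, 'wo, 'wm, 'o, 'm, 'n) fsketch" where
  "chordate_sketch C = \<lparr>fbase = chordate (base C), fcones = chordate_cone ` cones C\<rparr>"

end

theory Submission
  imports Defs
begin

text \<open>
  The two 2-categories are equal, so the isomorphism is the identity.  A tight morphism of the
  free \<open>\<F>\<close>-sketch is a composite of initial cone projections, because the indices of the
  induced weights are inchordate and contribute only identities.  The 2-cell components of a
  \<open>w\<close>-natural transformation at identities are identities, and those at composites are pasted from
  those at the factors; so being an identity at the initial cone projections and being an identity
  at every tight morphism are the same condition.  On objects, every morphism of the chordate
  \<open>\<F>\<close>-category is tight, so tightness imposes no condition on a model, and an \<open>\<F>\<close>-cone whose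
  weight is induced by a cleavage determines and is determined by its loose part.
\<close>

section \<open>Calculus of 2-cells\<close>

text \<open>That the isomorphism is an identity leaves two obligations. \<open>two_cat_iso\<close>
  asks for the 2-category axioms of \<open>Mod\<close>, for all four weaknesses. And 2-functors here
  are extensional, so the naturality equations require that whiskering, with models and with strict
  transformations between models, stays inside \<open>Mod\<close>. To avoid four parallel pasting
  calculations, those behind these facts are carried out for \<open>Lax\<close>.
  \<open>Strict\<close> and \<open>Pseudo\<close> add a condition on 2-cell components that is
  stable under pasting, and \<open>Colax\<close> is \<open>Lax\<close> over the 2-categories with
  reversed 2-cells. One passage between weaknesses remains: the 2-category of limit sketches has
  strict transformations as its 2-cells, while the 1-cells of \<open>Mod\<close> are only
  \<open>w\<close>-natural, so a strict transformation must be recognised as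
  \<open>w\<close>-natural for each \<open>w\<close>.\<close>

context two_category
begin

lemma s1_in [simp]: "f \<in> ar1 C \<Longrightarrow> s1 C f \<in> obj C"
  and t1_in [simp]: "f \<in> ar1 C \<Longrightarrow> t1 C f \<in> obj C"
  and id1_in [simp]: "x \<in> obj C \<Longrightarrow> id1 C x \<in> ar1 C"
  and s1_id1 [simp]: "x \<in> obj C \<Longrightarrow> s1 C (id1 C x) = x"
  and t1_id1 [simp]: "x \<in> obj C \<Longrightarrow> t1 C (id1 C x) = x"
  and comp1_in [simp]: "\<lbrakk>f \<in> ar1 C; g \<in> ar1 C; t1 C f = s1 C g\<rbrakk> \<Longrightarrow> g \<odot> f \<in> ar1 C"
  and s1_comp1 [simp]: "\<lbrakk>f \<in> ar1 C; g \<in> ar1 C; t1 C f = s1 C g\<rbrakk> \<Longrightarrow> s1 C (g \<odot> f) = s1 C f"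
  and t1_comp1 [simp]: "\<lbrakk>f \<in> ar1 C; g \<in> ar1 C; t1 C f = s1 C g\<rbrakk> \<Longrightarrow> t1 C (g \<odot> f) = t1 C g"
  and comp1_id_left [simp]: "\<lbrakk>f \<in> ar1 C; x = t1 C f\<rbrakk> \<Longrightarrow> id1 C x \<odot> f = f"
  and comp1_id_right [simp]: "\<lbrakk>f \<in> ar1 C; x = s1 C f\<rbrakk> \<Longrightarrow> f \<odot> id1 C x = f"
  and comp1_assoc [simp]: "\<lbrakk>f \<in> ar1 C; g \<in> ar1 C; h \<in> ar1 C; t1 C f = s1 C g; t1 C g = s1 C h\<rbrakk>
    \<Longrightarrow> (h \<odot> g) \<odot> f = h \<odot> (g \<odot> f)"
  using category.dom_ob[OF under_category] category.cod_ob[OF under_category]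
    category.id_ar[OF under_category] category.dom_id[OF under_category]
    category.cod_id[OF under_category] category.comp_ar[OF under_category]
    category.dom_comp[OF under_category] category.cod_comp[OF under_category]
    category.id_left[OF under_category] category.id_right[OF under_category]
    category.assoc[OF under_category]
  by (auto simp: under_cat_def)

lemma s2_in [simp]: "a \<in> ar2 C \<Longrightarrow> s2 C a \<in> ar1 C"
  and t2_in [simp]: "a \<in> ar2 C \<Longrightarrow> t2 C a \<in> ar1 C"
  and id2_in [simp]: "f \<in> ar1 C \<Longrightarrow> id2 C f \<in> ar2 C"
  and s2_id2 [simp]: "f \<in> ar1 C \<Longrightarrow> s2 C (id2 C f) = f"
  and t2_id2 [simp]: "f \<in> ar1 C \<Longrightarrow> t2 C (id2 C f) = f"
  and vcomp_in [simp]: "\<lbrakk>a \<in> ar2 C; b \<in> ar2 C; t2 C a = s2 C b\<rbrakk> \<Longrightarrow> b \<bullet> a \<in> ar2 C"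
  and s2_vcomp [simp]: "\<lbrakk>a \<in> ar2 C; b \<in> ar2 C; t2 C a = s2 C b\<rbrakk> \<Longrightarrow> s2 C (b \<bullet> a) = s2 C a"
  and t2_vcomp [simp]: "\<lbrakk>a \<in> ar2 C; b \<in> ar2 C; t2 C a = s2 C b\<rbrakk> \<Longrightarrow> t2 C (b \<bullet> a) = t2 C b"
  and vcomp_id_left [simp]: "\<lbrakk>a \<in> ar2 C; f = t2 C a\<rbrakk> \<Longrightarrow> id2 C f \<bullet> a = a"
  and vcomp_id_right [simp]: "\<lbrakk>a \<in> ar2 C; f = s2 C a\<rbrakk> \<Longrightarrow> a \<bullet> id2 C f = a"
  and vcomp_assoc [simp]: "\<lbrakk>a \<in> ar2 C; b \<in> ar2 C; c \<in> ar2 C; t2 C a = s2 C b; t2 C b = s2 C c\<rbrakk>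
    \<Longrightarrow> (c \<bullet> b) \<bullet> a = c \<bullet> (b \<bullet> a)"
  using category.dom_ob[OF vert_category] category.cod_ob[OF vert_category]
    category.id_ar[OF vert_category] category.dom_id[OF vert_category]
    category.cod_id[OF vert_category] category.comp_ar[OF vert_category]
    category.dom_comp[OF vert_category] category.cod_comp[OF vert_category]
    category.id_left[OF vert_category] category.id_right[OF vert_category]
    category.assoc[OF vert_category]
  by (auto simp: vert_cat_def)

text \<open>Orientation of the normal form: outer boundaries are read off the source 1-cell and
  horizontal composites of identities are merged. Together with associativity and distribution of
  whiskering, a pasting becomes a right-nested vertical composite of whiskered cells.\<close>

lemmas [simp] = globular_s[symmetric] globular_t[symmetric] s2_hcomp t2_hcomp id2_comp1[symmetric]

lemma hcomp_in [simp]: "\<lbrakk>a \<in> ar2 C; b \<in> ar2 C; t1 C (s2 C a) = s1 C (s2 C b)\<rbrakk> \<Longrightarrow> b \<star> a \<in> ar2 C"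
  and hcomp_id_left [simp]: "\<lbrakk>a \<in> ar2 C; x = t1 C (s2 C a)\<rbrakk> \<Longrightarrow> id2 C (id1 C x) \<star> a = a"
  and hcomp_id_right [simp]: "\<lbrakk>a \<in> ar2 C; x = s1 C (s2 C a)\<rbrakk> \<Longrightarrow> a \<star> id2 C (id1 C x) = a"
  and hcomp_assoc [simp]: "\<lbrakk>a \<in> ar2 C; b \<in> ar2 C; c \<in> ar2 C; t1 C (s2 C a) = s1 C (s2 C b);
      t1 C (s2 C b) = s1 C (s2 C c)\<rbrakk> \<Longrightarrow> (c \<star> b) \<star> a = c \<star> (b \<star> a)"
  using category.comp_ar[OF horiz_category]
    category.id_left[OF horiz_category] category.id_right[OF horiz_category]
    category.assoc[OF horiz_category]
  by (auto simp: horiz_cat_def)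

lemma whisker_vcomp [simp]: "\<lbrakk>a \<in> ar2 C; b \<in> ar2 C; f \<in> ar1 C; t2 C a = s2 C b; t1 C (s2 C a) = s1 C f\<rbrakk>
    \<Longrightarrow> id2 C f \<star> (b \<bullet> a) = (id2 C f \<star> b) \<bullet> (id2 C f \<star> a)"
  using interchange[of a b "id2 C f" "id2 C f"] by simp

lemma vcomp_whisker [simp]: "\<lbrakk>a \<in> ar2 C; b \<in> ar2 C; f \<in> ar1 C; t2 C a = s2 C b; t1 C f = s1 C (s2 C a)\<rbrakk>
    \<Longrightarrow> (b \<bullet> a) \<star> id2 C f = (b \<star> id2 C f) \<bullet> (a \<star> id2 C f)"
  using interchange[of "id2 C f" "id2 C f" a b] by simp

text \<open>Right nesting separates two adjacent identities from each other when a third factor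
  follows, so the merging rule for identities needs this variant with a tail.\<close>

lemma hcomp_id_id [simp]: "\<lbrakk>f \<in> ar1 C; g \<in> ar1 C; a \<in> ar2 C; t1 C f = s1 C g; t1 C (s2 C a) = s1 C f\<rbrakk>
    \<Longrightarrow> id2 C g \<star> (id2 C f \<star> a) = id2 C (g \<odot> f) \<star> a"
  using hcomp_assoc[of a "id2 C f" "id2 C g"] by (simp del: hcomp_assoc)

text \<open>Both sides equal \<open>b \<star> a\<close>: pad each factor with an identity, before or
  after, and interchange.\<close>

lemma exchange:
  assumes "a \<in> ar2 C" "b \<in> ar2 C" "t1 C (s2 C a) = s1 C (s2 C b)"
  shows "(id2 C (t2 C b) \<star> a) \<bullet> (b \<star> id2 C (s2 C a)) =
    (b \<star> id2 C (t2 C a)) \<bullet> (id2 C (s2 C b) \<star> a)"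
  using assms interchange[of "id2 C (s2 C a)" a b "id2 C (t2 C b)"]
    interchange[of a "id2 C (t2 C a)" "id2 C (s2 C b)" b] by simp

text \<open>In a right-nested composite the product \<open>b \<bullet> a\<close> is not a subterm
  once something precedes \<open>a\<close>. This carries an equation of pastings past such a tail
  \<open>c\<close>.\<close>

lemma vcomp_cong:
  assumes "b \<bullet> a = b' \<bullet> a'" "a \<in> ar2 C" "b \<in> ar2 C" "a' \<in> ar2 C" "b' \<in> ar2 C" "c \<in> ar2 C"
    "t2 C a = s2 C b" "t2 C a' = s2 C b'" "t2 C c = s2 C a" "s2 C a' = s2 C a"
  shows "b \<bullet> a \<bullet> c = b' \<bullet> a' \<bullet> c"
  using assms by (simp flip: vcomp_assoc)

lemma is_identity2_id [simp]: "f \<in> ar1 C \<Longrightarrow> is_identity2 C (id2 C f)"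
  by (simp add: is_identity2_def)

lemma is_identity2_eq_t: "is_identity2 C a \<Longrightarrow> a = id2 C (t2 C a)"
  by (auto simp: is_identity2_def)

lemma is_identity2_vcomp:
  "\<lbrakk>is_identity2 C a; is_identity2 C b; t2 C a = s2 C b\<rbrakk> \<Longrightarrow> is_identity2 C (b \<bullet> a)"
  by (auto simp: is_identity2_def)

lemma is_identity2_hcomp:
  "\<lbrakk>is_identity2 C a; is_identity2 C b; t1 C (s2 C a) = s1 C (s2 C b)\<rbrakk> \<Longrightarrow> is_identity2 C (b \<star> a)"
  by (auto simp: is_identity2_def)

lemma is_identity2_invertible: "is_identity2 C a \<Longrightarrow> is_invertible2 C a"
  using id2_in vcomp_id_left s2_id2 t2_id2 unfolding is_identity2_def is_invertible2_def by (metis imageE)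

lemma is_invertible2_vcomp:
  assumes "is_invertible2 C a" "is_invertible2 C b" "t2 C a = s2 C b"
  shows "is_invertible2 C (b \<bullet> a)"
proof -
  obtain a' where a: "a \<in> ar2 C" "a' \<in> ar2 C" "s2 C a' = t2 C a" "t2 C a' = s2 C a"
    "a' \<bullet> a = id2 C (s2 C a)" "a \<bullet> a' = id2 C (t2 C a)"
    using assms(1) by (auto simp: is_invertible2_def)
  obtain b' where b: "b \<in> ar2 C" "b' \<in> ar2 C" "s2 C b' = t2 C b" "t2 C b' = s2 C b"
    "b' \<bullet> b = id2 C (s2 C b)" "b \<bullet> b' = id2 C (t2 C b)"
    using assms(2) by (auto simp: is_invertible2_def)
  \<comment> \<open>The cancellations carry a tail because right nesting of
    \<open>(a' \<bullet> b') \<bullet> (b \<bullet> a)\<close> exposes \<open>b' \<bullet> b\<close>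
    only in front of \<open>a\<close>; likewise on the other side.\<close>
  have "b' \<bullet> b \<bullet> a = a" "a \<bullet> a' \<bullet> b' = b'"
    using a b assms(3) vcomp_assoc[of a b b'] vcomp_assoc[of b' a' a] by auto
  then have "(a' \<bullet> b') \<bullet> (b \<bullet> a) = id2 C (s2 C a)" "(b \<bullet> a) \<bullet> (a' \<bullet> b') = id2 C (t2 C b)"
    using a b assms(3) by auto
  then show ?thesis
    unfolding is_invertible2_def using a b assms(3)
    by (intro conjI bexI[of _ "a' \<bullet> b'"]) auto
qed

lemma is_invertible2_hcomp:
  assumes "is_invertible2 C a" "is_invertible2 C b" "t1 C (s2 C a) = s1 C (s2 C b)"
  shows "is_invertible2 C (b \<star> a)"
proof -
  obtain a' where a: "a \<in> ar2 C" "a' \<in> ar2 C" "s2 C a' = t2 C a" "t2 C a' = s2 C a"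
    "a' \<bullet> a = id2 C (s2 C a)" "a \<bullet> a' = id2 C (t2 C a)"
    using assms(1) by (auto simp: is_invertible2_def)
  obtain b' where b: "b \<in> ar2 C" "b' \<in> ar2 C" "s2 C b' = t2 C b" "t2 C b' = s2 C b"
    "b' \<bullet> b = id2 C (s2 C b)" "b \<bullet> b' = id2 C (t2 C b)"
    using assms(2) by (auto simp: is_invertible2_def)
  show ?thesis
    unfolding is_invertible2_def using a b assms(3)
      interchange[of a a' b b'] interchange[of a' a b' b]
    by (intro conjI bexI[of _ "b' \<star> a'"]) auto
qed

end

section \<open>Lax transformations and modifications\<close>

lemmas (in two_functor) [simp] = F0_in F1_in F2_in F1_s1 F1_t1 F2_s2 F2_t2 F1_id1 F2_id2
  F1_comp1 F2_vcomp F2_hcomp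

locale lax_trans = S: two_category S + C: two_category C + F: two_functor S C F + G: two_functor S C G
  for S :: "('o, 'm, 'n) twocat" and C :: "('p, 'q, 'r) twocat" and F G +
  fixes \<phi>
  assumes nat: "w_natural Lax S C \<phi>" and tsrc [simp]: "tsrc \<phi> = F" and ttgt [simp]: "ttgt \<phi> = G"
begin

lemma tob_ext: "tob \<phi> \<in> extensional (obj S)" and tar_ext: "tar \<phi> \<in> extensional (ar1 S)"
  and tob_in [simp]: "x \<in> obj S \<Longrightarrow> tob \<phi> x \<in> ar1 C"
  and s1_tob [simp]: "x \<in> obj S \<Longrightarrow> s1 C (tob \<phi> x) = F0 F x"
  and t1_tob [simp]: "x \<in> obj S \<Longrightarrow> t1 C (tob \<phi> x) = F0 G x"
  and tar_in [simp]: "f \<in> ar1 S \<Longrightarrow> tar \<phi> f \<in> ar2 C"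
  and s2_tar [simp]: "f \<in> ar1 S \<Longrightarrow> s2 C (tar \<phi> f) = F1 G f \<odot>\<^bsub>C\<^esub> tob \<phi> (s1 S f)"
  and t2_tar [simp]: "f \<in> ar1 S \<Longrightarrow> t2 C (tar \<phi> f) = tob \<phi> (t1 S f) \<odot>\<^bsub>C\<^esub> F1 F f"
  and tar_id1 [simp]: "x \<in> obj S \<Longrightarrow> tar \<phi> (id1 S x) = id2 C (tob \<phi> x)"
  and tar_comp1 [simp]: "\<lbrakk>f \<in> ar1 S; g \<in> ar1 S; t1 S f = s1 S g\<rbrakk> \<Longrightarrow> tar \<phi> (g \<odot>\<^bsub>S\<^esub> f) =
          (tar \<phi> g \<star>\<^bsub>C\<^esub> id2 C (F1 F f)) \<bullet>\<^bsub>C\<^esub> (id2 C (F1 G g) \<star>\<^bsub>C\<^esub> tar \<phi> f)"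
  and tar_nat: "a \<in> ar2 S \<Longrightarrow> (id2 C (tob \<phi> (t1 S (s2 S a))) \<star>\<^bsub>C\<^esub> F2 F a) \<bullet>\<^bsub>C\<^esub> tar \<phi> (s2 S a) =
          tar \<phi> (t2 S a) \<bullet>\<^bsub>C\<^esub> (F2 G a \<star>\<^bsub>C\<^esub> id2 C (tob \<phi> (s1 S (s2 S a))))"
  using nat unfolding w_natural_def lax_natural_def by (auto simp: Let_def)

end

lemma lax_transI:
  assumes "two_category S" "two_category C" "w_natural Lax S C \<phi>" "tsrc \<phi> = F" "ttgt \<phi> = G"
  shows "lax_trans S C F G \<phi>"
  using assms by (auto simp: lax_trans_def lax_trans_axioms_def w_natural_def)

lemma w_natural_id_trans_Lax:
  assumes "two_category S" "two_category C" "two_functor S C F"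
  shows "w_natural Lax S C (id_trans S C F)"
proof -
  interpret S: two_category S by fact
  interpret C: two_category C by fact
  interpret F: two_functor S C F by fact
  show ?thesis
    using F.two_functor_axioms by (simp add: w_natural_def lax_natural_def id_trans_def)
qed

lemma w_natural_comp_trans_Lax:
  assumes "lax_trans S C F G \<phi>" "lax_trans S C G H \<psi>"
  shows "w_natural Lax S C (comp_trans Lax S C \<psi> \<phi>)"
proof -
  interpret \<phi>: lax_trans S C F G \<phi> by fact
  interpret \<psi>: lax_trans S C G H \<psi> by fact
  show ?thesis
    unfolding w_natural_def lax_natural_def Let_def weakness.case
  proof (intro conjI ballI impI)
    fix f g assume fg [simp]: "f \<in> ar1 S" "g \<in> ar1 S" "t1 S f = s1 S g"
    show "tar (comp_trans Lax S C \<psi> \<phi>) (g \<odot>\<^bsub>S\<^esub> f) =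
      (tar (comp_trans Lax S C \<psi> \<phi>) g \<star>\<^bsub>C\<^esub> id2 C (F1 (tsrc (comp_trans Lax S C \<psi> \<phi>)) f)) \<bullet>\<^bsub>C\<^esub>
      (id2 C (F1 (ttgt (comp_trans Lax S C \<psi> \<phi>)) g) \<star>\<^bsub>C\<^esub> tar (comp_trans Lax S C \<psi> \<phi>) f)"
      \<comment> \<open>Expanding both sides gives the same four cells, except that the middle two,
        from \<open>tar \<phi> f\<close> and \<open>tar \<psi> g\<close>, come in opposite order.
        They act on horizontally adjacent 1-cells, so they exchange.\<close>
      using \<phi>.C.vcomp_cong[OF \<phi>.C.exchange[of "tar \<phi> f" "tar \<psi> g"]]
      by (simp add: comp_trans_def)
  next
    fix a assume a [simp]: "a \<in> ar2 S"
    show "(id2 C (tob (comp_trans Lax S C \<psi> \<phi>) (t1 S (s2 S a))) \<star>\<^bsub>C\<^esub>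
            F2 (tsrc (comp_trans Lax S C \<psi> \<phi>)) a) \<bullet>\<^bsub>C\<^esub> tar (comp_trans Lax S C \<psi> \<phi>) (s2 S a) =
         tar (comp_trans Lax S C \<psi> \<phi>) (t2 S a) \<bullet>\<^bsub>C\<^esub>
         (F2 (ttgt (comp_trans Lax S C \<psi> \<phi>)) a \<star>\<^bsub>C\<^esub>
          id2 C (tob (comp_trans Lax S C \<psi> \<phi>) (s1 S (s2 S a))))"
      \<comment> \<open>The 2-cell \<open>a\<close> moves through in two stages: past the cell of
        \<open>\<phi>\<close>, whiskered by \<open>\<psi>\<close> on the left, then past the cell of
        \<open>\<psi>\<close>, whiskered by \<open>\<phi>\<close> on the right.\<close>
      using \<phi>.C.vcomp_cong[OF arg_cong[OF \<phi>.tar_nat[OF a],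
          of "\<lambda>c. id2 C (tob \<psi> (t1 S (s2 S a))) \<star>\<^bsub>C\<^esub> c", simplified]]
        arg_cong[OF \<psi>.tar_nat[OF a], of "\<lambda>c. c \<star>\<^bsub>C\<^esub> id2 C (tob \<phi> (s1 S (s2 S a)))"]
      by (simp add: comp_trans_def)
  qed (use \<phi>.F.two_functor_axioms \<psi>.G.two_functor_axioms in \<open>simp_all add: comp_trans_def\<close>)
qed

locale lax_modification = \<phi>: lax_trans S C F G \<phi> + \<psi>: lax_trans S C F G \<psi>
  for S :: "('o, 'm, 'n) twocat" and C :: "('p, 'q, 'r) twocat" and F G \<phi> \<psi> +
  fixes \<mu>
  assumes modif: "modification Lax S C \<mu>" and msrc [simp]: "msrc \<mu> = \<phi>" and mtgt [simp]: "mtgt \<mu> = \<psi>"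
begin

lemma mob_in [simp]: "x \<in> obj S \<Longrightarrow> mob \<mu> x \<in> ar2 C"
  and s2_mob [simp]: "x \<in> obj S \<Longrightarrow> s2 C (mob \<mu> x) = tob \<phi> x"
  and t2_mob [simp]: "x \<in> obj S \<Longrightarrow> t2 C (mob \<mu> x) = tob \<psi> x"
  and mob_nat: "f \<in> ar1 S \<Longrightarrow> (mob \<mu> (t1 S f) \<star>\<^bsub>C\<^esub> id2 C (F1 F f)) \<bullet>\<^bsub>C\<^esub> tar \<phi> f =
                tar \<psi> f \<bullet>\<^bsub>C\<^esub> (id2 C (F1 G f) \<star>\<^bsub>C\<^esub> mob \<mu> (s1 S f))"
  using modif unfolding modification_def by (auto simp: Let_def)

end

lemma lax_modificationI:
  assumes "two_category S" "two_category C" "modification Lax S C \<mu>"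
    "tsrc (msrc \<mu>) = F" "ttgt (msrc \<mu>) = G" "msrc \<mu> = \<phi>" "mtgt \<mu> = \<psi>"
  shows "lax_modification S C F G \<phi> \<psi> \<mu>"
  using assms by (auto simp: lax_modification_def lax_modification_axioms_def modification_def Let_def
    intro!: lax_transI)

lemma (in lax_trans) modification_id_Lax:
  "modification Lax S C \<lparr>msrc = \<phi>, mtgt = \<phi>, mob = (\<lambda>x\<in>obj S. id2 C (tob \<phi> x))\<rparr>"
  using nat by (simp add: modification_def)

lemma modification_vcomp_Lax:
  assumes "lax_modification S C F G \<phi> \<psi> \<mu>" "lax_modification S C F G \<psi> \<chi> \<nu>"
  shows "modification Lax S C \<lparr>msrc = \<phi>, mtgt = \<chi>, mob = (\<lambda>x\<in>obj S. mob \<nu> x \<bullet>\<^bsub>C\<^esub> mob \<mu> x)\<rparr>"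
proof -
  interpret \<mu>: lax_modification S C F G \<phi> \<psi> \<mu> by fact
  interpret \<nu>: lax_modification S C F G \<psi> \<chi> \<nu> by fact
  show ?thesis
    using \<mu>.\<phi>.nat \<nu>.\<psi>.nat
    by (simp add: modification_def \<mu>.mob_nat \<mu>.\<phi>.C.vcomp_cong[OF \<nu>.mob_nat])
qed

lemma modification_hcomp_Lax:
  assumes "lax_modification S C F G \<phi> \<phi>' \<mu>" "lax_modification S C G H \<psi> \<psi>' \<nu>"
  shows "modification Lax S C \<lparr>msrc = comp_trans Lax S C \<psi> \<phi>, mtgt = comp_trans Lax S C \<psi>' \<phi>',
    mob = (\<lambda>x\<in>obj S. mob \<nu> x \<star>\<^bsub>C\<^esub> mob \<mu> x)\<rparr>"
proof -
  interpret \<mu>: lax_modification S C F G \<phi> \<phi>' \<mu> by fact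
  interpret \<nu>: lax_modification S C G H \<psi> \<psi>' \<nu> by fact
  have "(mob \<nu> (t1 S f) \<star>\<^bsub>C\<^esub> mob \<mu> (t1 S f) \<star>\<^bsub>C\<^esub> id2 C (F1 F f)) \<bullet>\<^bsub>C\<^esub>
      (id2 C (tob \<psi> (t1 S f)) \<star>\<^bsub>C\<^esub> tar \<phi> f) \<bullet>\<^bsub>C\<^esub> (tar \<psi> f \<star>\<^bsub>C\<^esub> id2 C (tob \<phi> (s1 S f)))
    = (id2 C (tob \<psi>' (t1 S f)) \<star>\<^bsub>C\<^esub> tar \<phi>' f) \<bullet>\<^bsub>C\<^esub> (tar \<psi>' f \<star>\<^bsub>C\<^esub> id2 C (tob \<phi>' (s1 S f)))
      \<bullet>\<^bsub>C\<^esub> (id2 C (F1 H f) \<star>\<^bsub>C\<^esub> mob \<nu> (s1 S f) \<star>\<^bsub>C\<^esub> mob \<mu> (s1 S f))" if f [simp]: "f \<in> ar1 S" for f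
  proof -
    \<comment> \<open>The product of the two modifications crosses the pasting one cell at a time.
      Crossing \<open>tar \<phi> f\<close> moves only \<open>\<mu>\<close> from the target to the
      source of \<open>f\<close>; crossing \<open>tar \<psi> f\<close> afterwards moves
      \<open>\<nu>\<close>. Interchange isolates the factor to which \<open>mob_nat\<close>
      applies.\<close>
    have "(mob \<nu> (t1 S f) \<star>\<^bsub>C\<^esub> mob \<mu> (t1 S f) \<star>\<^bsub>C\<^esub> id2 C (F1 F f)) \<bullet>\<^bsub>C\<^esub>
        (id2 C (tob \<psi> (t1 S f)) \<star>\<^bsub>C\<^esub> tar \<phi> f)
      = (id2 C (tob \<psi>' (t1 S f)) \<star>\<^bsub>C\<^esub> tar \<phi>' f)
        \<bullet>\<^bsub>C\<^esub> (mob \<nu> (t1 S f) \<star>\<^bsub>C\<^esub> id2 C (F1 G f) \<star>\<^bsub>C\<^esub> mob \<mu> (s1 S f))"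
      using \<mu>.\<phi>.C.interchange[of "tar \<phi> f" "mob \<mu> (t1 S f) \<star>\<^bsub>C\<^esub> id2 C (F1 F f)"
          "id2 C (tob \<psi> (t1 S f))" "mob \<nu> (t1 S f)"]
        \<mu>.\<phi>.C.interchange[of "id2 C (F1 G f) \<star>\<^bsub>C\<^esub> mob \<mu> (s1 S f)" "tar \<phi>' f"
          "mob \<nu> (t1 S f)" "id2 C (tob \<psi>' (t1 S f))"] \<mu>.mob_nat[OF f]
      by simp
    moreover have "(mob \<nu> (t1 S f) \<star>\<^bsub>C\<^esub> id2 C (F1 G f) \<star>\<^bsub>C\<^esub> mob \<mu> (s1 S f))
        \<bullet>\<^bsub>C\<^esub> (tar \<psi> f \<star>\<^bsub>C\<^esub> id2 C (tob \<phi> (s1 S f)))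
      = (tar \<psi>' f \<star>\<^bsub>C\<^esub> id2 C (tob \<phi>' (s1 S f)))
        \<bullet>\<^bsub>C\<^esub> (id2 C (F1 H f) \<star>\<^bsub>C\<^esub> mob \<nu> (s1 S f) \<star>\<^bsub>C\<^esub> mob \<mu> (s1 S f))"
      using \<mu>.\<phi>.C.interchange[of "id2 C (tob \<phi> (s1 S f))" "mob \<mu> (s1 S f)"
          "tar \<psi> f" "mob \<nu> (t1 S f) \<star>\<^bsub>C\<^esub> id2 C (F1 G f)"]
        \<mu>.\<phi>.C.interchange[of "mob \<mu> (s1 S f)" "id2 C (tob \<phi>' (s1 S f))"
          "id2 C (F1 H f) \<star>\<^bsub>C\<^esub> mob \<nu> (s1 S f)" "tar \<psi>' f"] \<nu>.mob_nat[OF f]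
      by simp
    ultimately show ?thesis by (subst \<mu>.\<phi>.C.vcomp_cong) auto
  qed
  then show ?thesis
    using w_natural_comp_trans_Lax[OF \<mu>.\<phi>.lax_trans_axioms \<nu>.\<phi>.lax_trans_axioms]
      w_natural_comp_trans_Lax[OF \<mu>.\<psi>.lax_trans_axioms \<nu>.\<psi>.lax_trans_axioms]
    by (simp add: modification_def comp_trans_def)
qed

lemma comp_trans_assoc_Lax:
  assumes "lax_trans S C F G \<phi>" "lax_trans S C G H \<psi>" "lax_trans S C H K \<chi>"
  shows "comp_trans Lax S C (comp_trans Lax S C \<chi> \<psi>) \<phi> =
    comp_trans Lax S C \<chi> (comp_trans Lax S C \<psi> \<phi>)"
proof -
  interpret \<phi>: lax_trans S C F G \<phi> by fact
  interpret \<psi>: lax_trans S C G H \<psi> by fact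
  interpret \<chi>: lax_trans S C H K \<chi> by fact
  show ?thesis by (auto simp: comp_trans_def intro!: restrict_ext)
qed

context lax_trans
begin

lemma comp_trans_id_left_Lax: "comp_trans Lax S C (id_trans S C G) \<phi> = \<phi>"
proof (rule trans.equality)
  show "tob (comp_trans Lax S C (id_trans S C G) \<phi>) = tob \<phi>"
    by (rule extensionalityI[OF _ tob_ext]) (simp_all add: comp_trans_def id_trans_def)
  show "tar (comp_trans Lax S C (id_trans S C G) \<phi>) = tar \<phi>"
    by (rule extensionalityI[OF _ tar_ext]) (simp_all add: comp_trans_def id_trans_def)
qed (simp_all add: comp_trans_def id_trans_def)

lemma comp_trans_id_right_Lax: "comp_trans Lax S C \<phi> (id_trans S C F) = \<phi>"
proof (rule trans.equality)
  show "tob (comp_trans Lax S C \<phi> (id_trans S C F)) = tob \<phi>"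
    by (rule extensionalityI[OF _ tob_ext]) (simp_all add: comp_trans_def id_trans_def)
  show "tar (comp_trans Lax S C \<phi> (id_trans S C F)) = tar \<phi>"
    by (rule extensionalityI[OF _ tar_ext]) (simp_all add: comp_trans_def id_trans_def)
qed (simp_all add: comp_trans_def id_trans_def)

end

section \<open>Transformations of arbitrary weakness\<close>

text \<open>Reversing all 2-cells turns colax transformations into lax ones, and reverses the
  modifications; the colax case of everything below is reduced to the lax one in this way.\<close>

definition co :: "('o, 'm, 'n) twocat \<Rightarrow> ('o, 'm, 'n) twocat" where
  "co C = C\<lparr>s2 := t2 C, t2 := s2 C, vcomp := \<lambda>b a. vcomp C a b\<rparr>"

lemma co_simps [simp]:
  "obj (co C) = obj C" "ar1 (co C) = ar1 C" "s1 (co C) = s1 C" "t1 (co C) = t1 C"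
  "id1 (co C) = id1 C" "comp1 (co C) = comp1 C" "ar2 (co C) = ar2 C" "s2 (co C) = t2 C"
  "t2 (co C) = s2 C" "id2 (co C) = id2 C" "vcomp (co C) b a = vcomp C a b" "hcomp (co C) = hcomp C"
  by (simp_all add: co_def)

lemma two_category_co:
  assumes "two_category C"
  shows "two_category (co C)"
proof -
  interpret two_category C by fact
  show ?thesis
    by unfold_locales (auto simp: under_cat_def vert_cat_def horiz_cat_def interchange)
qed

lemma two_functor_co:
  assumes "two_category S"
  shows "two_functor (co S) (co C) F \<longleftrightarrow> two_functor S C F"
proof -
  interpret two_category S by fact
  show ?thesis by (auto simp: two_functor_def)
qed

lemma is_identity2_co [simp]: "is_identity2 (co C) a \<longleftrightarrow> is_identity2 C a"
  by (simp add: is_identity2_def)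

text \<open>Reversal swaps source with target and the order of vertical composition, which yields
  the colax axioms with the two sides of the 2-cell naturality equation exchanged; hence
  \<open>eq_commute\<close>.\<close>

lemma lax_natural_co:
  assumes "two_category S" "two_functor S C (tsrc \<phi>)" "two_functor S C (ttgt \<phi>)"
  shows "lax_natural (co S) (co C) \<phi> \<longleftrightarrow> colax_natural S C \<phi>"
proof -
  interpret two_category S by fact
  show ?thesis
    unfolding lax_natural_def colax_natural_def Let_def
    by (intro iffI conjI ballI impI; (elim conjE)?) (simp_all add: eq_commute)
qed

text \<open>The reduction to \<open>Lax\<close>: \<open>Strict\<close> and \<open>Pseudo\<close>
  only add a pointwise condition on the 2-cell components, while \<open>Colax\<close> changes the
  ambient 2-categories and nothing in \<open>\<phi>\<close>.\<close>

lemma w_natural_iff: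
  assumes "two_category S"
  shows "w_natural w S C \<phi> \<longleftrightarrow> (if w = Colax then w_natural Lax (co S) (co C) \<phi>
    else w_natural Lax S C \<phi> \<and> (\<forall>f\<in>ar1 S. (w = Strict \<longrightarrow> is_identity2 C (tar \<phi> f)) \<and>
      (w = Pseudo \<longrightarrow> is_invertible2 C (tar \<phi> f))))"
  using lax_natural_co[OF assms] two_functor_co[OF assms] unfolding w_natural_def by (cases w) auto

lemma comp_trans_co: "comp_trans Lax (co S) (co C) = comp_trans Colax S C"
  by (simp add: comp_trans_def fun_eq_iff)

lemma comp_trans_Lax: "w \<noteq> Colax \<Longrightarrow> comp_trans w S C = comp_trans Lax S C"
  by (simp add: comp_trans_def fun_eq_iff)

lemma id_trans_co: "id_trans (co S) (co C) = id_trans S C"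
  by (simp add: id_trans_def fun_eq_iff)

text \<open>A component from \<open>\<phi>\<close> to \<open>\<psi>\<close> runs from
  \<open>\<psi>\<close> to \<open>\<phi>\<close> in \<open>co C\<close>. So the two ends trade
  places while the family \<open>mob \<mu>\<close> is kept.\<close>

lemma modification_iff:
  assumes "two_category S"
  shows "modification w S C \<mu> \<longleftrightarrow>
    (if w = Colax then modification Lax (co S) (co C) \<lparr>msrc = mtgt \<mu>, mtgt = msrc \<mu>, mob = mob \<mu>\<rparr>
     else modification Lax S C \<mu> \<and> w_natural w S C (msrc \<mu>) \<and> w_natural w S C (mtgt \<mu>))"
  unfolding modification_def Let_def
  using w_natural_iff[OF assms, of w C "msrc \<mu>"] w_natural_iff[OF assms, of w C "mtgt \<mu>"]
  by (auto split: if_splits)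

locale two_categories = S: two_category S + C: two_category C
  for S :: "('o, 'm, 'n) twocat" and C :: "('p, 'q, 'r) twocat" +
  fixes w :: weakness
begin

lemma w_natural_typing:
  assumes "w_natural w S C \<phi>"
  shows "two_functor S C (tsrc \<phi>)" "two_functor S C (ttgt \<phi>)"
    "tob \<phi> \<in> extensional (obj S)" "tar \<phi> \<in> extensional (ar1 S)"
    "x \<in> obj S \<Longrightarrow> tob \<phi> x \<in> ar1 C"
    "x \<in> obj S \<Longrightarrow> s1 C (tob \<phi> x) = F0 (tsrc \<phi>) x"
    "x \<in> obj S \<Longrightarrow> t1 C (tob \<phi> x) = F0 (ttgt \<phi>) x"
  using assms by (simp_all add: w_natural_def)

lemma modification_typing:
  assumes "modification w S C \<mu>"
  shows "w_natural w S C (msrc \<mu>)" "w_natural w S C (mtgt \<mu>)"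
    "tsrc (mtgt \<mu>) = tsrc (msrc \<mu>)" "ttgt (mtgt \<mu>) = ttgt (msrc \<mu>)"
    "mob \<mu> \<in> extensional (obj S)"
    "x \<in> obj S \<Longrightarrow> mob \<mu> x \<in> ar2 C"
    "x \<in> obj S \<Longrightarrow> s2 C (mob \<mu> x) = tob (msrc \<mu>) x"
    "x \<in> obj S \<Longrightarrow> t2 C (mob \<mu> x) = tob (mtgt \<mu>) x"
  using assms by (simp_all add: modification_def Let_def)

lemmas co_category = two_category_co[OF S.two_category_axioms] two_category_co[OF C.two_category_axioms]

text \<open>Packages the case distinction once. Facts for arbitrary \<open>w\<close> then follow by
  citing the \<open>Lax\<close> fact twice, at \<open>S\<close>, \<open>C\<close> and at
  \<open>co S\<close>, \<open>co C\<close>.\<close>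

lemma lax_trans_w:
  assumes "w_natural w S C \<phi>" "tsrc \<phi> = F" "ttgt \<phi> = G"
  shows "if w = Colax then lax_trans (co S) (co C) F G \<phi> else lax_trans S C F G \<phi>"
  using assms co_category S.two_category_axioms C.two_category_axioms
  by (auto simp: w_natural_iff[OF S.two_category_axioms, of w] intro!: lax_transI split: if_splits)

lemma comp_trans_w: "comp_trans w S C =
    (if w = Colax then comp_trans Lax (co S) (co C) else comp_trans Lax S C)"
  using comp_trans_Lax[of w] by (cases "w = Colax") (simp_all add: comp_trans_co)

lemma w_natural_id_trans:
  assumes "two_functor S C F"
  shows "w_natural w S C (id_trans S C F)"
proof -
  interpret F: two_functor S C F by fact
  show ?thesis
  using assms w_natural_id_trans_Lax[OF S.two_category_axioms C.two_category_axioms assms]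
    w_natural_id_trans_Lax[OF co_category, of F]
  by (auto simp: w_natural_iff[OF S.two_category_axioms, of w] id_trans_co
      two_functor_co[OF S.two_category_axioms])
    (auto simp: id_trans_def intro!: C.is_identity2_invertible)
qed

lemma w_natural_comp_trans:
  assumes "w_natural w S C \<phi>" "w_natural w S C \<psi>" "ttgt \<phi> = tsrc \<psi>"
  shows "w_natural w S C (comp_trans w S C \<psi> \<phi>)"
proof (cases "w = Colax")
  case True
  then show ?thesis
    using lax_trans_w[OF assms(1) refl assms(3)] lax_trans_w[OF assms(2) refl refl]
      w_natural_comp_trans_Lax[of "co S" "co C" "tsrc \<phi>" "tsrc \<psi>" \<phi> "ttgt \<psi>" \<psi>]
    by (simp add: w_natural_iff[OF S.two_category_axioms, of Colax] comp_trans_co)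
next
  case False
  obtain F G H where \<phi>: "lax_trans S C F G \<phi>" and \<psi>: "lax_trans S C G H \<psi>"
    using False lax_trans_w[OF assms(1) refl assms(3)] lax_trans_w[OF assms(2) refl refl] by simp
  interpret \<phi>: lax_trans S C F G \<phi> by fact
  interpret \<psi>: lax_trans S C G H \<psi> by fact
  have "w = Strict \<longrightarrow> is_identity2 C (tar (comp_trans Lax S C \<psi> \<phi>) f)"
    "w = Pseudo \<longrightarrow> is_invertible2 C (tar (comp_trans Lax S C \<psi> \<phi>) f)" if [simp]: "f \<in> ar1 S" for f
    using False assms(1,2) unfolding w_natural_iff[OF S.two_category_axioms, of w]
    by (auto simp: comp_trans_def intro!: C.is_identity2_vcomp C.is_invertible2_vcomp
      C.is_identity2_hcomp C.is_invertible2_hcomp C.is_identity2_invertible[OF C.is_identity2_id])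
  then show ?thesis
    using False w_natural_comp_trans_Lax[OF \<phi> \<psi>]
    unfolding w_natural_iff[OF S.two_category_axioms, of w] comp_trans_w by simp
qed

lemma comp_trans_sel [simp]: "tsrc (comp_trans w S C \<psi> \<phi>) = tsrc \<phi>" "ttgt (comp_trans w S C \<psi> \<phi>) = ttgt \<psi>"
  "x \<in> obj S \<Longrightarrow> tob (comp_trans w S C \<psi> \<phi>) x = tob \<psi> x \<odot>\<^bsub>C\<^esub> tob \<phi> x"
  by (simp_all add: comp_trans_def)

lemma id_trans_sel [simp]: "tsrc (id_trans S C F) = F" "ttgt (id_trans S C F) = F"
  "x \<in> obj S \<Longrightarrow> tob (id_trans S C F) x = id1 C (F0 F x)"
  by (simp_all add: id_trans_def)

lemma comp_trans_id_left: "w_natural w S C \<phi> \<Longrightarrow> ttgt \<phi> = G \<Longrightarrow> comp_trans w S C (id_trans S C G) \<phi> = \<phi>"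
  using lax_trans_w[OF _ refl, of \<phi> G] lax_trans.comp_trans_id_left_Lax[of S C "tsrc \<phi>" G \<phi>]
   lax_trans.comp_trans_id_left_Lax[of "co S" "co C" "tsrc \<phi>" G \<phi>]
  by (auto simp: comp_trans_w id_trans_co)

lemma comp_trans_id_right: "w_natural w S C \<phi> \<Longrightarrow> tsrc \<phi> = F \<Longrightarrow> comp_trans w S C \<phi> (id_trans S C F) = \<phi>"
  using lax_trans_w[OF _ _ refl, of \<phi> F] lax_trans.comp_trans_id_right_Lax[of S C F "ttgt \<phi>" \<phi>]
   lax_trans.comp_trans_id_right_Lax[of "co S" "co C" F "ttgt \<phi>" \<phi>]
  by (auto simp: comp_trans_w id_trans_co)

lemma comp_trans_assoc:
  assumes "w_natural w S C \<phi>" "w_natural w S C \<psi>" "w_natural w S C \<chi>" "ttgt \<phi> = tsrc \<psi>" "ttgt \<psi> = tsrc \<chi>"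
  shows "comp_trans w S C (comp_trans w S C \<chi> \<psi>) \<phi> = comp_trans w S C \<chi> (comp_trans w S C \<psi> \<phi>)"
  using lax_trans_w[OF assms(1) refl assms(4)] lax_trans_w[OF assms(2) refl assms(5)]
   lax_trans_w[OF assms(3) refl refl] comp_trans_assoc_Lax[of "co S" "co C" "tsrc \<phi>" "tsrc \<psi>" \<phi> "tsrc \<chi>" \<psi>]
    comp_trans_assoc_Lax[of S C "tsrc \<phi>" "tsrc \<psi>" \<phi> "tsrc \<chi>" \<psi>]
  by (auto simp: comp_trans_w split: if_splits)

lemma lax_modification_w:
  assumes "modification w S C \<mu>" "tsrc (msrc \<mu>) = F" "ttgt (msrc \<mu>) = G" "msrc \<mu> = \<phi>" "mtgt \<mu> = \<psi>"
  shows "if w = Colax then lax_modification (co S) (co C) F G \<psi> \<phi> \<lparr>msrc = \<psi>, mtgt = \<phi>, mob = mob \<mu>\<rparr>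
    else lax_modification S C F G \<phi> \<psi> \<mu>"
  using assms modification_typing(3,4)[OF assms(1)] co_category S.two_category_axioms C.two_category_axioms
  by (auto simp: modification_iff[OF S.two_category_axioms, of w] intro!: lax_modificationI)

lemma modification_id:
  assumes "w_natural w S C \<phi>"
  shows "modification w S C \<lparr>msrc = \<phi>, mtgt = \<phi>, mob = (\<lambda>x\<in>obj S. id2 C (tob \<phi> x))\<rparr>"
  using lax_trans_w[OF assms refl refl] lax_trans.modification_id_Lax[of S C "tsrc \<phi>" "ttgt \<phi>" \<phi>]
    lax_trans.modification_id_Lax[of "co S" "co C" "tsrc \<phi>" "ttgt \<phi>" \<phi>] assms
  by (auto simp: modification_iff[OF S.two_category_axioms, of w])

lemma modification_vcomp:
  assumes "modification w S C \<mu>" "modification w S C \<nu>" "mtgt \<mu> = msrc \<nu>"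
  shows "modification w S C \<lparr>msrc = msrc \<mu>, mtgt = mtgt \<nu>, mob = (\<lambda>x\<in>obj S. mob \<nu> x \<bullet>\<^bsub>C\<^esub> mob \<mu> x)\<rparr>"
proof -
  have st: "tsrc (msrc \<nu>) = tsrc (msrc \<mu>)" "ttgt (msrc \<nu>) = ttgt (msrc \<mu>)"
    using modification_typing(3,4)[OF assms(1)] assms(3) by auto
  \<comment> \<open>For \<open>w = Colax\<close> the order of composition is reversed as well: over
    \<open>co S\<close> and \<open>co C\<close> the flipped \<open>\<nu>\<close> comes first and the
    flipped \<open>\<mu>\<close> second, with the same middle transformation
    \<open>msrc \<nu>\<close>.\<close>
  show ?thesis
    using lax_modification_w[OF assms(1) refl refl refl assms(3)] lax_modification_w[OF assms(2) st refl refl]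
      modification_vcomp_Lax[of S C _ _ "msrc \<mu>" "msrc \<nu>" \<mu> "mtgt \<nu>" \<nu>]
      modification_vcomp_Lax[of "co S" "co C" _ _ "mtgt \<nu>" "msrc \<nu>" _ "msrc \<mu>"]
      modification_typing(1,2)[OF assms(1)] modification_typing(1,2)[OF assms(2)]
    by (auto simp: modification_iff[OF S.two_category_axioms, of w] split: if_splits) fastforce
qed

lemma modification_hcomp:
  assumes "modification w S C \<mu>" "modification w S C \<nu>" "ttgt (msrc \<mu>) = tsrc (msrc \<nu>)"
  shows "modification w S C \<lparr>msrc = comp_trans w S C (msrc \<nu>) (msrc \<mu>),
    mtgt = comp_trans w S C (mtgt \<nu>) (mtgt \<mu>), mob = (\<lambda>x\<in>obj S. mob \<nu> x \<star>\<^bsub>C\<^esub> mob \<mu> x)\<rparr>"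
proof -
  have "w_natural w S C (comp_trans w S C (msrc \<nu>) (msrc \<mu>))" "w_natural w S C (comp_trans w S C (mtgt \<nu>) (mtgt \<mu>))"
    using modification_typing[OF assms(1)] modification_typing[OF assms(2)] assms(3)
    by (auto intro!: w_natural_comp_trans)
  then show ?thesis
    using lax_modification_w[OF assms(1) refl assms(3) refl refl] lax_modification_w[OF assms(2) refl refl refl refl]
      modification_hcomp_Lax[of S C _ _ "msrc \<mu>" "mtgt \<mu>" \<mu> _ "msrc \<nu>" "mtgt \<nu>" \<nu>]
      modification_hcomp_Lax[of "co S" "co C" _ _ "mtgt \<mu>" "msrc \<mu>" _ _ "mtgt \<nu>" "msrc \<nu>"]
    by (auto simp: modification_iff[OF S.two_category_axioms, of w] comp_trans_w split: if_splits) fastforce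
qed

text \<open>Closure of \<open>Q\<close> under identities and composites is all that is asked: the
  sub-2-category is locally full, so a 2-cell is constrained only through its two ends.\<close>

lemma two_category_functor_twocat:
  assumes id: "\<And>F. \<lbrakk>two_functor S C F; P F\<rbrakk> \<Longrightarrow> Q (id_trans S C F)"
    and comp: "\<And>\<phi> \<psi>. \<lbrakk>w_natural w S C \<phi>; w_natural w S C \<psi>; ttgt \<phi> = tsrc \<psi>; Q \<phi>; Q \<psi>\<rbrakk>
      \<Longrightarrow> Q (comp_trans w S C \<psi> \<phi>)"
  shows "two_category (functor_twocat w S C P Q)"
proof -
  let ?T = "functor_twocat w S C P Q"
  have under: "category (under_cat ?T)"
    by unfold_locales (simp_all add: functor_twocat_def Let_def under_cat_def id comp w_natural_id_trans
      w_natural_typing w_natural_comp_trans comp_trans_id_left comp_trans_id_right comp_trans_assoc)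
  \<comment> \<open>Extensionality of \<open>mob\<close> reduces each law for modifications, an
    equation of records, to the corresponding law for their components in \<open>C\<close>.\<close>
  have ext: "\<mu> = \<nu>" if "msrc \<mu> = msrc \<nu>" "mtgt \<mu> = mtgt \<nu>" "mob \<mu> \<in> extensional (obj S)"
    "mob \<nu> \<in> extensional (obj S)" "\<And>x. x \<in> obj S \<Longrightarrow> mob \<mu> x = mob \<nu> x"
    for \<mu> \<nu> :: "('o, 'm, 'n, 'p, 'q, 'r) modif"
    using that by (intro modif.equality extensionalityI[of "mob \<mu>"]) auto
  have vert: "category (vert_cat ?T)"
    by unfold_locales (auto simp: functor_twocat_def Let_def vert_cat_def modification_id
      modification_vcomp w_natural_typing modification_typing intro!: ext)
  have horiz: "category (horiz_cat ?T)"
    by unfold_locales (auto simp: functor_twocat_def Let_def horiz_cat_def modification_id id comp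
      modification_hcomp w_natural_id_trans w_natural_comp_trans comp_trans_id_left comp_trans_id_right comp_trans_assoc
      w_natural_typing modification_typing intro!: ext)
  show ?thesis
  proof (intro two_category.intro under vert horiz)
    fix f g assume "f \<in> ar1 ?T" "g \<in> ar1 ?T" "t1 ?T f = s1 ?T g"
    then show "id2 ?T (g \<odot>\<^bsub>?T\<^esub> f) = id2 ?T g \<star>\<^bsub>?T\<^esub> id2 ?T f"
      by (auto simp: functor_twocat_def Let_def w_natural_typing intro!: ext)
  next
    fix a a' b b' assume "a \<in> ar2 ?T" "a' \<in> ar2 ?T" "b \<in> ar2 ?T" "b' \<in> ar2 ?T"
      "t2 ?T a = s2 ?T a'" "t2 ?T b = s2 ?T b'" "t1 ?T (s2 ?T a) = s1 ?T (s2 ?T b)"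
    then show "(b' \<bullet>\<^bsub>?T\<^esub> b) \<star>\<^bsub>?T\<^esub> (a' \<bullet>\<^bsub>?T\<^esub> a) = (b' \<star>\<^bsub>?T\<^esub> a') \<bullet>\<^bsub>?T\<^esub> (b \<star>\<^bsub>?T\<^esub> a)"
      by (intro ext) (simp_all add: functor_twocat_def Let_def modification_typing w_natural_typing C.interchange)
  qed (simp_all add: functor_twocat_def Let_def modification_typing)
qed

end

section \<open>Whiskering\<close>

lemma two_functor_comp:
  assumes "two_category S" "two_functor S C F" "two_functor C D H"
  shows "two_functor S D (comp_twofun S H F)"
proof -
  interpret S: two_category S by fact
  interpret F: two_functor S C F by fact
  interpret H: two_functor C D H by fact
  show ?thesis by unfold_locales (simp_all add: comp_twofun_def)
qed

lemma comp_twofun_co: "comp_twofun (co S) = comp_twofun S"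
  by (simp add: comp_twofun_def fun_eq_iff)

lemma postwhisker_trans_co: "postwhisker_trans (co S) = postwhisker_trans S"
  by (simp add: postwhisker_trans_def fun_eq_iff comp_twofun_co)

lemma prewhisker_trans_co: "prewhisker_trans (co S) = prewhisker_trans S"
  by (simp add: prewhisker_trans_def fun_eq_iff comp_twofun_co)

lemma (in two_functor) F2_is_identity2: "is_identity2 C a \<Longrightarrow> is_identity2 D (F2 F a)"
  by (auto simp: is_identity2_def)

lemma (in two_functor) F2_is_invertible2:
  assumes "is_invertible2 C a" "two_category C"
  shows "is_invertible2 D (F2 F a)"
proof -
  interpret C: two_category C by fact
  obtain b where "a \<in> ar2 C" "b \<in> ar2 C" "s2 C b = t2 C a" "t2 C b = s2 C a"
    "b \<bullet>\<^bsub>C\<^esub> a = id2 C (s2 C a)" "a \<bullet>\<^bsub>C\<^esub> b = id2 C (t2 C a)"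
    using assms(1) by (auto simp: is_invertible2_def)
  then show ?thesis
    unfolding is_invertible2_def
    by (intro conjI bexI[of _ "F2 F b"]) (simp_all flip: F2_vcomp)
qed

lemma (in lax_trans) postwhisker_Lax:
  assumes "two_category D" "two_functor C D H"
  shows "w_natural Lax S D (postwhisker_trans S H \<phi>)"
proof -
  interpret D: two_category D by fact
  interpret H: two_functor C D H by fact
  have eq: "(id2 D (F1 H (tob \<phi> (t1 S (s2 S a)))) \<star>\<^bsub>D\<^esub> F2 H (F2 F a)) \<bullet>\<^bsub>D\<^esub> F2 H (tar \<phi> (s2 S a)) =
      F2 H (tar \<phi> (t2 S a)) \<bullet>\<^bsub>D\<^esub> (F2 H (F2 G a) \<star>\<^bsub>D\<^esub> id2 D (F1 H (tob \<phi> (s1 S (s2 S a)))))"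
    if a [simp]: "a \<in> ar2 S" for a
    using arg_cong[OF tar_nat[OF a], of "F2 H"] by simp
  show ?thesis
    using two_functor_comp[OF S.two_category_axioms F.two_functor_axioms assms(2)]
      two_functor_comp[OF S.two_category_axioms G.two_functor_axioms assms(2)]
    by (simp add: w_natural_def lax_natural_def postwhisker_trans_def)
      (simp add: comp_twofun_def eq)
qed

lemma (in lax_modification) postwhisker_modif_Lax:
  assumes "two_category D" "two_functor C D H"
  shows "modification Lax S D (postwhisker_modif S H \<mu>)"
proof -
  interpret D: two_category D by fact
  interpret H: two_functor C D H by fact
  have eq: "(F2 H (mob \<mu> (t1 S f)) \<star>\<^bsub>D\<^esub> id2 D (F1 H (F1 F f))) \<bullet>\<^bsub>D\<^esub> F2 H (tar \<phi> f) =
      F2 H (tar \<psi> f) \<bullet>\<^bsub>D\<^esub> (id2 D (F1 H (F1 G f)) \<star>\<^bsub>D\<^esub> F2 H (mob \<mu> (s1 S f)))"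
    if f [simp]: "f \<in> ar1 S" for f
    using arg_cong[OF mob_nat[OF f], of "F2 H"] by simp
  show ?thesis
    using \<phi>.postwhisker_Lax[OF assms] \<psi>.postwhisker_Lax[OF assms]
    by (simp add: modification_def postwhisker_modif_def)
      (simp add: postwhisker_trans_def comp_twofun_def eq)
qed

lemma (in lax_trans) prewhisker_Lax:
  assumes "two_category R" "two_functor R S M"
  shows "w_natural Lax R C (prewhisker_trans R \<phi> M)"
proof -
  interpret R: two_category R by fact
  interpret M: two_functor R S M by fact
  have eq: "(id2 C (tob \<phi> (F0 M (t1 R (s2 R a)))) \<star>\<^bsub>C\<^esub> F2 F (F2 M a)) \<bullet>\<^bsub>C\<^esub> tar \<phi> (F1 M (s2 R a)) =
      tar \<phi> (F1 M (t2 R a)) \<bullet>\<^bsub>C\<^esub> (F2 G (F2 M a) \<star>\<^bsub>C\<^esub> id2 C (tob \<phi> (F0 M (s1 R (s2 R a)))))"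
    if [simp]: "a \<in> ar2 R" for a
    using tar_nat[of "F2 M a"] by simp
  show ?thesis
    using two_functor_comp[OF R.two_category_axioms assms(2) F.two_functor_axioms]
      two_functor_comp[OF R.two_category_axioms assms(2) G.two_functor_axioms]
    by (simp add: w_natural_def lax_natural_def prewhisker_trans_def)
      (simp add: comp_twofun_def eq)
qed

section \<open>Transformations whose 2-cell components are identities\<close>

lemma (in lax_trans) is_identity2_tar_id1: "x \<in> obj S \<Longrightarrow> is_identity2 C (tar \<phi> (id1 S x))"
  by simp

lemma (in lax_trans) is_identity2_tar_comp1:
  "\<lbrakk>f \<in> ar1 S; g \<in> ar1 S; t1 S f = s1 S g; is_identity2 C (tar \<phi> f); is_identity2 C (tar \<phi> g)\<rbrakk>
    \<Longrightarrow> is_identity2 C (tar \<phi> (g \<odot>\<^bsub>S\<^esub> f))"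
  by (auto intro!: C.is_identity2_vcomp C.is_identity2_hcomp)

lemma is_identity2_tar_comp_trans_Lax:
  assumes "lax_trans S C F G \<phi>" "lax_trans S C G H \<psi>" "f \<in> ar1 S"
    "is_identity2 C (tar \<phi> f)" "is_identity2 C (tar \<psi> f)"
  shows "is_identity2 C (tar (comp_trans Lax S C \<psi> \<phi>) f)"
proof -
  interpret \<phi>: lax_trans S C F G \<phi> by fact
  interpret \<psi>: lax_trans S C G H \<psi> by fact
  show ?thesis
    using assms by (auto simp: comp_trans_def intro!: \<phi>.C.is_identity2_vcomp \<phi>.C.is_identity2_hcomp)
qed

context two_categories
begin

lemma is_identity2_tar_id1:
  assumes "w_natural w S C \<phi>" "x \<in> obj S"
  shows "is_identity2 C (tar \<phi> (id1 S x))"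
  using lax_trans_w[OF assms(1) refl refl] assms(2)
    lax_trans.is_identity2_tar_id1[of S C _ _ \<phi> x] lax_trans.is_identity2_tar_id1[of "co S" "co C" _ _ \<phi> x]
  by (auto split: if_splits)

lemma is_identity2_tar_comp1:
  assumes "w_natural w S C \<phi>" "f \<in> ar1 S" "g \<in> ar1 S" "t1 S f = s1 S g"
    "is_identity2 C (tar \<phi> f)" "is_identity2 C (tar \<phi> g)"
  shows "is_identity2 C (tar \<phi> (g \<odot>\<^bsub>S\<^esub> f))"
  using lax_trans_w[OF assms(1) refl refl] assms(2-)
    lax_trans.is_identity2_tar_comp1[of S C _ _ \<phi> f g] lax_trans.is_identity2_tar_comp1[of "co S" "co C" _ _ \<phi> f g]
  by (auto split: if_splits)

lemma is_identity2_tar_comp_trans: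
  assumes "w_natural w S C \<phi>" "w_natural w S C \<psi>" "ttgt \<phi> = tsrc \<psi>" "f \<in> ar1 S"
    "is_identity2 C (tar \<phi> f)" "is_identity2 C (tar \<psi> f)"
  shows "is_identity2 C (tar (comp_trans w S C \<psi> \<phi>) f)"
  using lax_trans_w[OF assms(1) refl assms(3)] lax_trans_w[OF assms(2) refl refl] assms(4-)
    is_identity2_tar_comp_trans_Lax[of S C _ _ \<phi> _ \<psi> f]
    is_identity2_tar_comp_trans_Lax[of "co S" "co C" _ _ \<phi> _ \<psi> f]
  by (auto simp: comp_trans_w split: if_splits)

section \<open>Whiskering for arbitrary weakness\<close>

lemma w_natural_postwhisker:
  assumes "two_category D" "two_functor C D H" "w_natural w S C \<phi>"
  shows "w_natural w S D (postwhisker_trans S H \<phi>)"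
proof -
  have "two_functor (co C) (co D) H" "two_category (co D)"
    using assms(1,2) by (auto simp: two_functor_co[OF C.two_category_axioms] two_category_co)
  then show ?thesis
  using assms lax_trans_w[OF assms(3) refl refl] lax_trans.postwhisker_Lax[of S C _ _ \<phi> D H]
    lax_trans.postwhisker_Lax[of "co S" "co C" _ _ \<phi> "co D" H]
    two_functor.F2_is_identity2[OF assms(2)] two_functor.F2_is_invertible2[OF assms(2) _ C.two_category_axioms]
  unfolding w_natural_iff[OF S.two_category_axioms, of w]
  by (auto simp: postwhisker_trans_co postwhisker_trans_def split: if_splits)
qed

lemma modification_postwhisker:
  assumes "two_category D" "two_functor C D H" "modification w S C \<mu>"
  shows "modification w S D (postwhisker_modif S H \<mu>)"
proof -
  have "two_functor (co C) (co D) H" "two_category (co D)"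
    using assms(1,2) by (auto simp: two_functor_co[OF C.two_category_axioms] two_category_co)
  then show ?thesis
  using assms(1,2) lax_modification_w[OF assms(3) refl refl refl refl]
    lax_modification.postwhisker_modif_Lax[of S C _ _ _ _ \<mu> D H]
    lax_modification.postwhisker_modif_Lax[of "co S" "co C" _ _ _ _ _ "co D" H]
    w_natural_postwhisker[OF assms(1,2) modification_typing(1)[OF assms(3)]]
    w_natural_postwhisker[OF assms(1,2) modification_typing(2)[OF assms(3)]]
  unfolding modification_iff[OF S.two_category_axioms, of w]
  by (auto simp: postwhisker_trans_co postwhisker_modif_def split: if_splits) fastforce
qed

text \<open>Not definitional for \<open>w = Colax\<close>: the naturality equations have to be turned around.\<close>

lemma w_natural_Strict:
  assumes "w_natural Strict S C \<phi>"
  shows "w_natural w S C \<phi>"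
proof -
  have lax: "w_natural Lax S C \<phi>" and id: "\<And>f. f \<in> ar1 S \<Longrightarrow> is_identity2 C (tar \<phi> f)"
    using assms by (auto simp: w_natural_def)
  obtain F G where *: "lax_trans S C F G \<phi>"
    using lax_transI[OF S.two_category_axioms C.two_category_axioms lax] by blast
  interpret \<phi>: lax_trans S C F G \<phi> by fact
  have tar: "tar \<phi> f = id2 C (tob \<phi> (t1 S f) \<odot>\<^bsub>C\<^esub> F1 F f)" if "f \<in> ar1 S" for f
    using that C.is_identity2_eq_t[OF id[OF that]] by simp
  \<comment> \<open>An identity 2-cell has equal source and target, so comparing the two prescribed
    boundaries of \<open>tar \<phi> f\<close> gives a commuting naturality square.\<close>
  have sq: "F1 G f \<odot>\<^bsub>C\<^esub> tob \<phi> (s1 S f) = tob \<phi> (t1 S f) \<odot>\<^bsub>C\<^esub> F1 F f" if "f \<in> ar1 S" for f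
    using that arg_cong[OF tar[OF that], of "s2 C"] by simp
  have "F1 G g \<odot>\<^bsub>C\<^esub> tob \<phi> (t1 S f) \<odot>\<^bsub>C\<^esub> F1 F f = tob \<phi> (t1 S g) \<odot>\<^bsub>C\<^esub> F1 F g \<odot>\<^bsub>C\<^esub> F1 F f"
    if "f \<in> ar1 S" "g \<in> ar1 S" "t1 S f = s1 S g" for f g
    using that sq[OF that(2)] C.comp1_assoc[of "F1 F f" "tob \<phi> (t1 S f)" "F1 G g"] by simp
  moreover have "F2 G a \<star>\<^bsub>C\<^esub> id2 C (tob \<phi> (s1 S (s2 S a))) = id2 C (tob \<phi> (t1 S (s2 S a))) \<star>\<^bsub>C\<^esub> F2 F a"
    if [simp]: "a \<in> ar2 S" for a
    using \<phi>.tar_nat[of a] tar[of "s2 S a"] tar[of "t2 S a"] sq[of "t2 S a"] by simp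
  ultimately have "colax_natural S C \<phi>"
    by (auto simp: colax_natural_def tar sq)
  then show ?thesis
    using lax id C.is_identity2_invertible by (cases w) (auto simp: w_natural_def)
qed

lemma w_natural_prewhisker:
  assumes "two_category R" "two_functor R S M" "w_natural w S C \<phi>"
  shows "w_natural w R C (prewhisker_trans R \<phi> M)"
proof -
  interpret M: two_functor R S M by fact
  have "two_functor (co R) (co S) M" "two_category (co R)"
    using assms(1,2) by (auto simp: two_functor_co two_category_co)
  then show ?thesis
  using assms lax_trans_w[OF assms(3) refl refl] lax_trans.prewhisker_Lax[of S C _ _ \<phi> R M]
    lax_trans.prewhisker_Lax[of "co S" "co C" _ _ \<phi> "co R" M]
  unfolding w_natural_iff[OF S.two_category_axioms, of w] w_natural_iff[OF assms(1), of w]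
  by (auto simp: prewhisker_trans_co prewhisker_trans_def split: if_splits)
qed

end

text \<open>Equality on the nose is possible because \<open>P\<close> and \<open>Q\<close> enter
  only through the carriers, always conjoined with 2-functoriality and \<open>w\<close>-naturality;
  the operations do not mention them.\<close>

lemma functor_twocat_cong:
  assumes "\<And>F. two_functor S C F \<Longrightarrow> P F \<longleftrightarrow> P' F" "\<And>\<phi>. w_natural w S C \<phi> \<Longrightarrow> Q \<phi> \<longleftrightarrow> Q' \<phi>"
  shows "functor_twocat w S C P Q = functor_twocat w S C P' Q'"
proof -
  have "{F. two_functor S C F \<and> P F} = {F. two_functor S C F \<and> P' F}"
    using assms(1) by auto
  moreover have "{\<phi>. w_natural w S C \<phi> \<and> tsrc \<phi> \<in> Fs \<and> ttgt \<phi> \<in> Fs \<and> Q \<phi>} =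
      {\<phi>. w_natural w S C \<phi> \<and> tsrc \<phi> \<in> Fs \<and> ttgt \<phi> \<in> Fs \<and> Q' \<phi>}" for Fs
    using assms(2) by auto
  ultimately show ?thesis by (simp add: functor_twocat_def)
qed

lemma two_functor_id:
  assumes "two_category C"
  shows "two_functor C C (id_twofun C)"
proof -
  interpret two_category C by fact
  show ?thesis by unfold_locales (simp_all add: id_twofun_def)
qed

lemma two_cat_iso_id:
  assumes "two_category C"
  shows "two_cat_iso C C (id_twofun C)"
proof -
  have "comp_twofun C (id_twofun C) (id_twofun C) = id_twofun C"
    by (simp add: comp_twofun_def id_twofun_def cong: restrict_cong)
  then show ?thesis
    unfolding two_cat_iso_def using assms two_functor_id[OF assms] by blast
qed

section \<open>Projections of cones and images of cones\<close>

lemma proj_in: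
  assumes "is_cone S \<gamma>" "(j, y) \<in> el_ob (cweight \<gamma>)"
  shows "proj \<gamma> j y \<in> ar1 S"
proof -
  have j: "j \<in> obj (widx (cweight \<gamma>))" and y: "y \<in> Ob (wob (cweight \<gamma>) j)"
    using assms(2) by (auto simp: el_ob_def)
  then have "cat_functor (wob (cweight \<gamma>) j) (hom_cat S (capex \<gamma>) (F0 (cdiag \<gamma>) j)) (cleg \<gamma> j)"
    using assms(1) by (auto simp: is_cone_def Let_def)
  from cat_functor.fob_in[OF this y] show ?thesis
    by (simp add: proj_def hom_cat_def)
qed

text \<open>Each chosen object lies in its own component. This guarantees that an initial projection
  is the value of a leg inside its carrier, where it is a genuine 1-cell.\<close>

lemma chosen_subset:
  assumes "is_cleavage W \<Omega>"
  shows "chosen W \<Omega> \<subseteq> el_ob W"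
proof -
  have "fst (\<Omega> K) \<in> K" if "K \<in> el_components W" for K
    using assms that by (simp add: is_cleavage_def naturally_weakly_initial_def)
  moreover have "K \<subseteq> el_ob W" if "K \<in> el_components W" for K
    using that unfolding el_components_def by blast
  ultimately show ?thesis unfolding chosen_def by blast
qed

text \<open>\<open>comp_twofun\<close> is \<open>undefined\<close> off the carriers of
  \<open>S\<close>, so the proof first places the diagram, the apex and all legs of
  \<open>\<gamma>\<close> in \<open>S\<close>.\<close>

lemma image_cone_comp:
  assumes "is_cone S \<gamma>"
  shows "image_cone (comp_twofun S H F) \<gamma> = image_cone H (image_cone F \<gamma>)"
proof -
  define J where "J = widx (cweight \<gamma>)"
  interpret D: two_functor J S "cdiag \<gamma>"
    using assms by (simp add: is_cone_def Let_def J_def)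
  have legs: "cat_functor (wob (cweight \<gamma>) j) (hom_cat S (capex \<gamma>) (F0 (cdiag \<gamma>) j)) (cleg \<gamma> j)"
    if "j \<in> obj J" for j
    using assms that by (simp add: is_cone_def Let_def J_def)
  have "fob (cleg \<gamma> j) y \<in> ar1 S" if "j \<in> obj J" "y \<in> Ob (wob (cweight \<gamma>) j)" for j y
    using cat_functor.fob_in[OF legs] that by (simp add: hom_cat_def)
  moreover have "far (cleg \<gamma> j) u \<in> ar2 S" if "j \<in> obj J" "u \<in> Ar (wob (cweight \<gamma>) j)" for j u
    using cat_functor.far_in[OF legs] that by (simp add: hom_cat_def)
  moreover have "capex \<gamma> \<in> obj S"
    using assms by (simp add: is_cone_def Let_def)
  ultimately show ?thesis
    by (auto simp: image_cone_def Let_def comp_twofun_def image_legs_def J_def[symmetric] intro!: restrict_ext)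
qed

section \<open>Cones of the free and the chordate \<open>\<F>\<close>-sketch\<close>

text \<open>A section of \<open>loose_cone\<close>. When \<open>\<Psi>\<close> consists of the
  weights induced by the cleavages of a sketch, it parametrises
  \<open>enhanced_cones\<close>.\<close>

definition induced_cone ::
  "('jo, 'jm, 'wo) cleavage \<Rightarrow> ('jo, 'jm, 'jn, 'wo, 'wm, 'o, 'm, 'n) cone
    \<Rightarrow> ('jo, 'jm, 'jn, 'wo, 'wm, 'wo, 'wm, 'o, 'm, 'n) fcone" where
  "induced_cone \<Omega> \<gamma> =
     \<lparr>fcweight = induced_weight (cweight \<gamma>) \<Omega>, fcdiag = cdiag \<gamma>, fcapex = capex \<gamma>, fcleg = cleg \<gamma>\<rparr>"

lemma restrict_extensional_eq:
  assumes "f \<in> extensional A" "\<And>x. x \<in> A \<Longrightarrow> g x = f x"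
  shows "restrict g A = f"
  using assms by (intro extensionalityI[of _ A]) auto

text \<open>An equality and not just an isomorphism because \<open>wob W\<close> is extensional:
  restricting it to the objects of the index gives the same function back.\<close>

lemma loose_weight_induced_weight:
  assumes "is_weight W"
  shows "loose_weight (induced_weight W \<Omega>) = W"
proof -
  interpret is_weight W by fact
  show ?thesis
    by (rule weight.equality)
      (auto simp: loose_weight_def induced_weight_def inchordate_def full_inclusion_def Let_def
        intro!: restrict_extensional_eq[OF wob_ext])
qed

lemma loose_weight_chordate_weight:
  assumes "is_weight W"
  shows "loose_weight (chordate_weight W) = W"
proof -
  interpret is_weight W by fact
  show ?thesis
    by (rule weight.equality)
      (auto simp: loose_weight_def chordate_weight_def chordate_def identity_fobj_def
        intro!: restrict_extensional_eq[OF wob_ext])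
qed

lemma loose_cone_induced_cone: "is_weight (cweight \<gamma>) \<Longrightarrow> loose_cone (induced_cone \<Omega> \<gamma>) = \<gamma>"
  by (simp add: loose_cone_def induced_cone_def loose_weight_induced_weight)

lemma loose_cone_chordate_cone: "is_weight (cweight \<gamma>) \<Longrightarrow> loose_cone (chordate_cone \<gamma>) = \<gamma>"
  by (simp add: loose_cone_def chordate_cone_def loose_weight_chordate_weight)

lemma is_cone_weight: "is_cone S \<gamma> \<Longrightarrow> is_weight (cweight \<gamma>)"
  by (simp add: is_cone_def Let_def)

text \<open>A cone might a priori underlie several \<open>\<F>\<close>-cones. But
  \<open>loose_weight\<close> recovers \<open>W\<close> from
  \<open>induced_weight W (\<Omega> W)\<close>, and the cleavage depends on the weight alone, so
  exactly one weight in \<open>\<Psi>\<close> lies over the weight of a given cone.\<close>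

lemma enhanced_cones_induced_weights:
  assumes "is_sketch S" "\<Psi> = {induced_weight W (\<Omega> W) | W. W \<in> weights S}"
  shows "enhanced_cones S \<Psi> = (\<lambda>\<gamma>. induced_cone (\<Omega> (cweight \<gamma>)) \<gamma>) ` cones S"
proof (intro equalityI subsetI)
  fix \<gamma> assume \<gamma>: "\<gamma> \<in> enhanced_cones S \<Psi>"
  then obtain W where W: "W \<in> weights S" "fcweight \<gamma> = induced_weight W (\<Omega> W)"
    using assms(2) by (auto simp: enhanced_cones_def)
  have "is_weight W"
    using W(1) assms(1) by (auto simp: weights_def is_sketch_def dest: is_cone_weight)
  then have "cweight (loose_cone \<gamma>) = W"
    by (simp add: loose_cone_def W(2) loose_weight_induced_weight)
  then have "\<gamma> = induced_cone (\<Omega> (cweight (loose_cone \<gamma>))) (loose_cone \<gamma>)"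
    by (simp add: induced_cone_def W(2)) (simp add: loose_cone_def W(2)[symmetric])
  then show "\<gamma> \<in> (\<lambda>\<gamma>. induced_cone (\<Omega> (cweight \<gamma>)) \<gamma>) ` cones S"
    using \<gamma> by (auto simp: enhanced_cones_def)
next
  fix \<gamma> assume "\<gamma> \<in> (\<lambda>\<gamma>. induced_cone (\<Omega> (cweight \<gamma>)) \<gamma>) ` cones S"
  then obtain \<delta> where \<delta>: "\<delta> \<in> cones S" "\<gamma> = induced_cone (\<Omega> (cweight \<delta>)) \<delta>" by auto
  then have "is_weight (cweight \<delta>)"
    using assms(1) is_cone_weight unfolding is_sketch_def by blast
  then have "loose_cone \<gamma> = \<delta>"
    using \<delta>(2) by (simp add: loose_cone_induced_cone)
  then show "\<gamma> \<in> enhanced_cones S \<Psi>"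
    using \<delta> assms(2) by (auto simp: enhanced_cones_def induced_cone_def weights_def)
qed

lemma loose_cone_image_induced_cone:
  assumes "is_weight (cweight \<gamma>)"
  shows "loose_cone (image_fcone F (induced_cone \<Omega> \<gamma>)) = image_cone F \<gamma>"
proof -
  let ?W = "induced_weight (cweight \<gamma>) \<Omega>"
  have J: "loose (fwidx ?W) = widx (cweight \<gamma>)"
    by (simp add: induced_weight_def inchordate_def)
  have "lpart (fwob ?W j) = wob (cweight \<gamma>) j" if "j \<in> obj (widx (cweight \<gamma>))" for j
    using that by (simp add: induced_weight_def full_inclusion_def Let_def)
  then have "image_legs F (obj (widx (cweight \<gamma>))) (\<lambda>j. lpart (fwob ?W j)) =
      image_legs F (obj (widx (cweight \<gamma>))) (wob (cweight \<gamma>))"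
    by (auto simp: image_legs_def fun_eq_iff restrict_def)
  then show ?thesis
    by (simp add: loose_cone_def image_fcone_def image_cone_def induced_cone_def Let_def J
      loose_weight_induced_weight[OF assms])
qed

lemma cat_functor_id_full_subcategory:
  assumes "category A"
  shows "cat_functor (A\<lparr>Ob := {x \<in> Ob A. x \<in> P}, Ar := {a \<in> Ar A. Dom A a \<in> P \<and> Cod A a \<in> P}\<rparr>) A
    (id_func (A\<lparr>Ob := {x \<in> Ob A. x \<in> P}, Ar := {a \<in> Ar A. Dom A a \<in> P \<and> Cod A a \<in> P}\<rparr>))"
proof -
  interpret category A by fact
  show ?thesis
    by unfold_locales (auto simp: id_func_def dom_ob cod_ob id_ar dom_id cod_id comp_ar dom_comp cod_comp)
qed

lemma cat_functor_id:
  assumes "category A"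
  shows "cat_functor A A (id_func A)"
proof -
  interpret category A by fact
  show ?thesis
    by unfold_locales (auto simp: id_func_def dom_ob cod_ob id_ar comp_ar)
qed

text \<open>Any functor into an identity embedding restricts to tight parts; here the restriction is
  the inclusion of the full subcategory.\<close>

lemma tight_functor_full_inclusion:
  assumes "category A"
  shows "tight_functor (full_inclusion A P) (identity_fobj A) (id_func A)"
proof -
  let ?B = "A\<lparr>Ob := {x \<in> Ob A. x \<in> P}, Ar := {a \<in> Ar A. Dom A a \<in> P \<and> Cod A a \<in> P}\<rparr>"
  have "cat_functor ?B A (id_func ?B)"
    by (rule cat_functor_id_full_subcategory[OF assms])
  then show ?thesis
    unfolding tight_functor_def full_inclusion_def identity_fobj_def Let_def fobj.simps
    using cat_functor_id[OF assms] by blast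
qed

text \<open>Only the equation of loose parts has content. The other clauses ask that whatever is
  tight for the induced weight be tight for the chordate one, for which every morphism and every
  object is tight. Matching a cone up to restriction thus becomes equality of 2-categorical
  cones.\<close>

lemma restricts_to_chordate_cone_iff:
  assumes "is_weight (cweight \<gamma>)" "is_weight (cweight \<delta>)"
  shows "restricts_to (chordate_cone \<delta>) (image_fcone F (induced_cone \<Omega> \<gamma>)) \<longleftrightarrow> \<delta> = image_cone F \<gamma>"
proof
  assume "restricts_to (chordate_cone \<delta>) (image_fcone F (induced_cone \<Omega> \<gamma>))"
  then show "\<delta> = image_cone F \<gamma>"
    using assms by (simp add: restricts_to_def loose_cone_chordate_cone loose_cone_image_induced_cone)
next
  assume eq: "\<delta> = image_cone F \<gamma>"
  then have W: "cweight \<delta> = cweight \<gamma>" by (simp add: image_cone_def Let_def)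
  interpret W: is_weight "cweight \<gamma>" by fact
  interpret J: two_category "widx (cweight \<gamma>)" by (rule W.idx)
  have fw: "fcweight (image_fcone F (induced_cone \<Omega> \<gamma>)) = induced_weight (cweight \<gamma>) \<Omega>"
    "fcweight (chordate_cone \<delta>) = chordate_weight (cweight \<gamma>)"
    by (simp_all add: image_fcone_def induced_cone_def chordate_cone_def Let_def W)
  have lpart: "lpart (full_inclusion A P) = A" for A :: "('wo, 'wm) cat" and P
    by (simp add: full_inclusion_def Let_def)
  show "restricts_to (chordate_cone \<delta>) (image_fcone F (induced_cone \<Omega> \<gamma>))"
    unfolding restricts_to_def loose_cone_chordate_cone[OF assms(2)] loose_cone_image_induced_cone[OF assms(1)]
      fw using eq tight_functor_full_inclusion[OF W.wob_category]
    by (auto simp: induced_weight_def chordate_weight_def inchordate_def chordate_def lpart)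
qed

lemma is_model_comp:
  assumes "is_sketch S" "is_model S C F" "is_model C D H"
  shows "is_model S D (comp_twofun (base S) H F)"
proof -
  have F: "two_functor (base S) (base C) F" and H: "two_functor (base C) (base D) H"
    and S: "two_category (base S)"
    using assms by (simp_all only: is_model_def is_sketch_def)
  have "image_cone (comp_twofun (base S) H F) \<gamma> \<in> cones D" if \<gamma>: "\<gamma> \<in> cones S" for \<gamma>
  proof -
    have "is_cone (base S) \<gamma>"
      using assms(1) \<gamma> by (simp only: is_sketch_def)
    moreover have "image_cone F \<gamma> \<in> cones C"
      using assms(2) \<gamma> by (simp only: is_model_def)
    ultimately show ?thesis
      using assms(3) image_cone_comp[of "base S" \<gamma> H F] by (simp only: is_model_def)
  qed
  then show ?thesis
    using two_functor_comp[OF S F H] unfolding is_model_def by blast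
qed

section \<open>Models of a cloven sketch\<close>

locale cloven_sketch =
  fixes S :: "('jo, 'jm, 'jn, 'wo, 'wm, 'o, 'm, 'n) sketch"
    and \<Omega> :: "('jo, 'jm, 'jn, 'wo, 'wm) weight \<Rightarrow> ('jo, 'jm, 'wo) cleavage"
    and \<Psi> :: "('jo, 'jm, 'jn, 'wo, 'wm, 'wo, 'wm) fweight set"
  assumes cloven: "cloven_flexible_sketch S \<Omega>"
    and Psi: "\<Psi> = {induced_weight W (\<Omega> W) | W. W \<in> weights S}"
begin

lemma sketch: "is_sketch S"
  using cloven by (simp add: cloven_flexible_sketch_def)

lemma base_two_category: "two_category (base S)"
  using sketch by (simp add: is_sketch_def)

lemma cone: "\<gamma> \<in> cones S \<Longrightarrow> is_cone (base S) \<gamma>"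
  using sketch by (simp add: is_sketch_def)

lemmas enhanced_cones_eq = enhanced_cones_induced_weights[OF sketch Psi]

lemma initial_projection_in:
  assumes "\<gamma> \<in> cones S" "(j, y) \<in> chosen (cweight \<gamma>) (\<Omega> (cweight \<gamma>))"
  shows "proj \<gamma> j y \<in> ar1 (base S)"
proof -
  have "is_cleavage (cweight \<gamma>) (\<Omega> (cweight \<gamma>))"
    using assms(1) cloven by (simp add: cloven_flexible_sketch_def weights_def)
  then show ?thesis
    using proj_in[OF cone[OF assms(1)]] chosen_subset assms(2) by blast
qed

text \<open>The tight part of an induced weight is embedded by an inclusion, so the generator that
  \<open>free_proj\<close> supplies at \<open>y\<close> is the projection at \<open>y\<close>
  itself.\<close>

lemma initial_projection_tight:
  assumes "\<gamma> \<in> cones S" "(j, y) \<in> chosen (cweight \<gamma>) (\<Omega> (cweight \<gamma>))"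
  shows "proj \<gamma> j y \<in> free_tight S \<Psi>"
proof -
  let ?\<Omega> = "\<Omega> (cweight \<gamma>)"
  have "is_cleavage (cweight \<gamma>) ?\<Omega>"
    using assms(1) cloven by (simp add: cloven_flexible_sketch_def weights_def)
  then have "(j, y) \<in> el_ob (cweight \<gamma>)"
    using chosen_subset assms(2) by blast
  then have j: "j \<in> obj (widx (cweight \<gamma>))" "y \<in> Ob (wob (cweight \<gamma>) j)"
    by (auto simp: el_ob_def)
  let ?\<gamma> = "induced_cone ?\<Omega> \<gamma>"
  have "?\<gamma> \<in> enhanced_cones S \<Psi>"
    using assms(1) by (simp add: enhanced_cones_eq)
  moreover have "j \<in> obj (loose (fwidx (fcweight ?\<gamma>)))"
    using j by (simp add: induced_cone_def induced_weight_def inchordate_def)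
  moreover have "y \<in> Ob (tpart (fwob (fcweight ?\<gamma>) j))" "fob (emb (fwob (fcweight ?\<gamma>) j)) y = y"
    using j assms(2)
    by (simp_all add: induced_cone_def induced_weight_def full_inclusion_def Let_def id_func_def)
  ultimately show ?thesis
    using free_proj[of ?\<gamma> S \<Psi> j y] loose_cone_induced_cone[OF is_cone_weight[OF cone[OF assms(1)]]]
    by simp
qed

text \<open>Membership in \<open>ar1 (base S)\<close> is proved simultaneously with
  \<open>P\<close>, because the composition hypothesis may use it for both factors. No case for
  diagram morphisms is left: a 2-functor sends identities to identities, so they fall under
  \<open>id\<close>.\<close>

lemma free_tight_induct [consumes 1, case_names id comp proj]:
  assumes "f \<in> free_tight S \<Psi>"
    and id: "\<And>x. x \<in> obj (base S) \<Longrightarrow> P (id1 (base S) x)"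
    and comp: "\<And>f g. \<lbrakk>f \<in> ar1 (base S); g \<in> ar1 (base S); t1 (base S) f = s1 (base S) g; P f; P g\<rbrakk>
      \<Longrightarrow> P (g \<odot>\<^bsub>base S\<^esub> f)"
    and proj: "\<And>\<gamma> j y. \<lbrakk>\<gamma> \<in> cones S; (j, y) \<in> chosen (cweight \<gamma>) (\<Omega> (cweight \<gamma>))\<rbrakk> \<Longrightarrow> P (proj \<gamma> j y)"
  shows "f \<in> ar1 (base S) \<and> P f"
  using assms(1)
proof induction
  case (free_id x)
  then show ?case using two_category.id1_in[OF base_two_category] id by blast
next
  case (free_comp f g)
  then show ?case using two_category.comp1_in[OF base_two_category] comp by blast
next
  case (free_diag \<gamma> f)
  then obtain \<delta> where \<delta>: "\<delta> \<in> cones S" "\<gamma> = induced_cone (\<Omega> (cweight \<delta>)) \<delta>"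
    by (auto simp: enhanced_cones_eq)
  interpret D: two_functor "widx (cweight \<delta>)" "base S" "cdiag \<delta>"
    using cone[OF \<delta>(1)] by (simp add: is_cone_def Let_def)
  obtain j where j: "j \<in> obj (widx (cweight \<delta>))" "f = id1 (widx (cweight \<delta>)) j"
    using free_diag(2) \<delta>(2) by (auto simp: induced_cone_def induced_weight_def inchordate_def)
  have "F1 (fcdiag \<gamma>) f = id1 (base S) (F0 (cdiag \<delta>) j)"
    using j \<delta>(2) by (simp add: induced_cone_def)
  then show ?case
    using two_category.id1_in[OF base_two_category] id D.F0_in[OF j(1)] by simp
next
  case (free_proj \<gamma> j y)
  then obtain \<delta> where \<delta>: "\<delta> \<in> cones S" "\<gamma> = induced_cone (\<Omega> (cweight \<delta>)) \<delta>"
    by (auto simp: enhanced_cones_eq)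
  have j: "j \<in> obj (widx (cweight \<delta>))"
    using free_proj(2) \<delta>(2) by (simp add: induced_cone_def induced_weight_def inchordate_def)
  have "(j, y) \<in> chosen (cweight \<delta>) (\<Omega> (cweight \<delta>))" "fob (emb (fwob (fcweight \<gamma>) j)) y = y"
    using free_proj(3) j
    by (simp_all add: \<delta>(2) induced_cone_def induced_weight_def full_inclusion_def Let_def id_func_def)
  moreover have "loose_cone \<gamma> = \<delta>"
    unfolding \<delta>(2) by (rule loose_cone_induced_cone[OF is_cone_weight[OF cone[OF \<delta>(1)]]])
  ultimately show ?case
    using initial_projection_in[OF \<delta>(1)] proj[OF \<delta>(1)] by simp
qed

lemma free_tight_subset: "free_tight S \<Psi> \<subseteq> ar1 (base S)"
  by (blast dest: free_tight_induct[where P = "\<lambda>_. True"])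

section \<open>Comparison of models and transformations on the two sides\<close>

lemma is_fmodel_iff:
  assumes "is_sketch C"
  shows "is_fmodel (free_fsketch S \<Psi>) (chordate_sketch C) F \<longleftrightarrow> is_model S C F"
proof -
  have weight: "is_weight (cweight \<delta>)" if "\<delta> \<in> cones C" for \<delta>
    using assms that is_cone_weight unfolding is_sketch_def by blast
  have "restricts_to (chordate_cone \<delta>) (image_fcone F (induced_cone (\<Omega> (cweight \<gamma>)) \<gamma>)) \<longleftrightarrow>
      \<delta> = image_cone F \<gamma>" if "\<gamma> \<in> cones S" "\<delta> \<in> cones C" for \<gamma> \<delta>
    by (rule restricts_to_chordate_cone_iff[OF is_cone_weight[OF cone[OF that(1)]] weight[OF that(2)]])
  then have cones: "(\<exists>\<delta>\<in>cones C. restricts_to (chordate_cone \<delta>)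
        (image_fcone F (induced_cone (\<Omega> (cweight \<gamma>)) \<gamma>))) \<longleftrightarrow> image_cone F \<gamma> \<in> cones C"
    if "\<gamma> \<in> cones S" for \<gamma>
    using that by auto
  have "F1 F f \<in> ar1 (base C)" if "two_functor (base S) (base C) F" "f \<in> free_tight S \<Psi>" for f
    using two_functor.F1_in[OF that(1)] free_tight_subset that(2) by blast
  then have "f_functor (fbase (free_fsketch S \<Psi>)) (fbase (chordate_sketch C)) F \<longleftrightarrow>
      two_functor (base S) (base C) F"
    by (auto simp: f_functor_def free_fsketch_def chordate_sketch_def chordate_def)
  then show ?thesis
    using cones by (simp add: is_fmodel_def is_model_def free_fsketch_def chordate_sketch_def enhanced_cones_eq)
qed

abbreviation initial_identities where
  "initial_identities K \<phi> \<equiv> \<forall>\<gamma>\<in>cones S. \<forall>(j, y)\<in>chosen (cweight \<gamma>) (\<Omega> (cweight \<gamma>)).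
    is_identity2 K (tar \<phi> (proj \<gamma> j y))"

lemma tight_identities_iff:
  assumes "two_category K" "w_natural w (base S) K \<phi>"
  shows "(\<forall>f\<in>free_tight S \<Psi>. is_identity2 K (tar \<phi> f)) \<longleftrightarrow> initial_identities K \<phi>"
proof -
  interpret two_categories "base S" K w
    using base_two_category assms(1) by (simp add: two_categories_def)
  have "is_identity2 K (tar \<phi> f)" if "initial_identities K \<phi>" "f \<in> free_tight S \<Psi>" for f
    using free_tight_induct[OF that(2), where P = "\<lambda>f. is_identity2 K (tar \<phi> f)"] that(1)
      is_identity2_tar_id1[OF assms(2)] is_identity2_tar_comp1[OF assms(2)] by blast
  then show ?thesis
    using initial_projection_tight by blast
qed

lemma loose_FMod:
  assumes "is_sketch C"
  shows "loose (FMod w (free_fsketch S \<Psi>) (chordate_sketch C)) = Mod w S \<Omega> C"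
proof -
  have "two_category (base C)"
    using assms by (simp add: is_sketch_def)
  then have "functor_twocat w (base S) (base C) (is_fmodel (free_fsketch S \<Psi>) (chordate_sketch C))
      (\<lambda>\<phi>. \<forall>f\<in>free_tight S \<Psi>. is_identity2 (base C) (tar \<phi> f)) = Mod w S \<Omega> C"
    unfolding Mod_def by (intro functor_twocat_cong is_fmodel_iff[OF assms] tight_identities_iff)
  then show ?thesis
    by (simp add: FMod_def Let_def free_fsketch_def chordate_sketch_def chordate_def)
qed

lemma two_category_Mod:
  assumes "is_sketch C"
  shows "two_category (Mod w S \<Omega> C)"
proof -
  interpret two_categories "base S" "base C" w
    using base_two_category assms by (simp add: two_categories_def is_sketch_def)
  show ?thesis
    unfolding Mod_def
  proof (rule two_category_functor_twocat)
    fix F assume F: "two_functor (base S) (base C) F"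
    show "initial_identities (base C) (id_trans (base S) (base C) F)"
      using initial_projection_in two_functor.F1_in[OF F] by (auto simp: id_trans_def)
  next
    fix \<phi> \<psi>
    assume "w_natural w (base S) (base C) \<phi>" "w_natural w (base S) (base C) \<psi>" "ttgt \<phi> = tsrc \<psi>"
      "initial_identities (base C) \<phi>" "initial_identities (base C) \<psi>"
    then show "initial_identities (base C) (comp_trans w (base S) (base C) \<psi> \<phi>)"
      using initial_projection_in by (fast intro: is_identity2_tar_comp_trans)
  qed
qed

section \<open>Naturality in the target sketch: stability of \<open>Mod\<close> under
  whiskering\<close>

lemma Mod_sel:
  "M \<in> obj (Mod w S \<Omega> C) \<longleftrightarrow> is_model S C M"
  "\<phi> \<in> ar1 (Mod w S \<Omega> C) \<longleftrightarrow> w_natural w (base S) (base C) \<phi> \<and> is_model S C (tsrc \<phi>) \<and>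
     is_model S C (ttgt \<phi>) \<and> initial_identities (base C) \<phi>"
  "\<mu> \<in> ar2 (Mod w S \<Omega> C) \<longleftrightarrow> modification w (base S) (base C) \<mu> \<and>
     msrc \<mu> \<in> ar1 (Mod w S \<Omega> C) \<and> mtgt \<mu> \<in> ar1 (Mod w S \<Omega> C)"
  by (auto simp: Mod_def functor_twocat_def Let_def is_model_def)

text \<open>Models compose, and a 2-functor preserves identity 2-cells, so the condition at initial
  projections survives application of \<open>H\<close>.\<close>

lemma postwhisker_in_Mod:
  assumes "is_sketch C" "is_sketch C'" "is_model C C' H" "\<phi> \<in> ar1 (Mod w S \<Omega> C)"
  shows "postwhisker_trans (base S) H \<phi> \<in> ar1 (Mod w S \<Omega> C')"
proof -
  interpret two_categories "base S" "base C" w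
    using base_two_category assms by (simp add: two_categories_def is_sketch_def)
  have H: "two_functor (base C) (base C') H" and C': "two_category (base C')"
    using assms by (simp_all add: is_model_def is_sketch_def)
  have "initial_identities (base C') (postwhisker_trans (base S) H \<phi>)"
    using assms(4) initial_projection_in two_functor.F2_is_identity2[OF H]
    by (fastforce simp: Mod_sel postwhisker_trans_def)
  then show ?thesis
    using w_natural_postwhisker[OF C' H] is_model_comp[OF sketch _ assms(3)] assms(4)
    by (auto simp: Mod_sel postwhisker_trans_def)
qed

lemma postwhisker_modif_in_Mod:
  assumes "is_sketch C" "is_sketch C'" "is_model C C' H" "\<mu> \<in> ar2 (Mod w S \<Omega> C)"
  shows "postwhisker_modif (base S) H \<mu> \<in> ar2 (Mod w S \<Omega> C')"
proof -
  interpret two_categories "base S" "base C" w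
    using base_two_category assms by (simp add: two_categories_def is_sketch_def)
  have H: "two_functor (base C) (base C') H" and C': "two_category (base C')"
    using assms by (simp_all add: is_model_def is_sketch_def)
  show ?thesis
    using modification_postwhisker[OF C' H] postwhisker_in_Mod[OF assms(1-3)] assms(4)
    by (simp add: Mod_sel(3)) (simp add: postwhisker_modif_def)
qed

text \<open>Since \<open>\<alpha>\<close> is strict, its component at every 1-cell is an identity,
  in particular at the image under \<open>M\<close> of an initial projection. Only then is it
  regarded as \<open>w\<close>-natural and whiskered.\<close>

lemma prewhisker_in_Mod:
  assumes "is_sketch C" "is_sketch C'" "is_model C C' (tsrc \<alpha>)" "is_model C C' (ttgt \<alpha>)"
    "w_natural Strict (base C) (base C') \<alpha>" "M \<in> obj (Mod w S \<Omega> C)"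
  shows "prewhisker_trans (base S) \<alpha> M \<in> ar1 (Mod w S \<Omega> C')"
proof -
  interpret two_categories "base C" "base C'" w
    using assms by (simp add: two_categories_def is_sketch_def)
  have M: "is_model S C M" and M': "two_functor (base S) (base C) M"
    using assms(6) by (simp_all add: Mod_sel is_model_def)
  have "is_identity2 (base C') (tar \<alpha> f)" if "f \<in> ar1 (base C)" for f
    using assms(5) that by (simp add: w_natural_def)
  then have "initial_identities (base C') (prewhisker_trans (base S) \<alpha> M)"
    using initial_projection_in two_functor.F1_in[OF M'] by (auto simp: prewhisker_trans_def)
  then show ?thesis
    using w_natural_prewhisker[OF base_two_category M' w_natural_Strict[OF assms(5)]]
      is_model_comp[OF sketch M] assms(3,4)
    by (auto simp: Mod_sel prewhisker_trans_def)
qed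

end

theorem theorem8p29:
  fixes S :: "('jo, 'jm, 'jn, 'wo, 'wm, 'o, 'm, 'n) sketch"
    and \<Omega> :: "('jo, 'jm, 'jn, 'wo, 'wm) weight \<Rightarrow> ('jo, 'jm, 'wo) cleavage"
    and \<Psi> :: "('jo, 'jm, 'jn, 'wo, 'wm, 'wo, 'wm) fweight set"
    and w :: weakness
  assumes cloven: "cloven_flexible_sketch S \<Omega>"
    and \<Psi>_def: "\<Psi> = {induced_weight W (\<Omega> W) | W. W \<in> weights S}"
  defines "L \<equiv> (\<lambda>C :: ('jo, 'jm, 'jn, 'wo, 'wm, 'p, 'q, 'r) sketch. Mod w S \<Omega> C)"
    and "R \<equiv> (\<lambda>C :: ('jo, 'jm, 'jn, 'wo, 'wm, 'p, 'q, 'r) sketch.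
                loose (FMod w (free_fsketch S \<Psi>) (chordate_sketch C)))"
  shows "\<exists>\<Theta>.
     (\<forall>C. is_sketch C \<longrightarrow> two_cat_iso (L C) (R C) (\<Theta> C)) \<and>
     (\<forall>C C' H. is_sketch C \<and> is_sketch C' \<and> is_model C C' H \<longrightarrow>
        comp_twofun (L C) (postcomp (R C) (base S) H) (\<Theta> C) =
        comp_twofun (L C) (\<Theta> C') (postcomp (L C) (base S) H)) \<and>
     (\<forall>C C' \<alpha>. is_sketch C \<and> is_sketch C' \<and> is_model C C' (tsrc \<alpha>) \<and> is_model C C' (ttgt \<alpha>) \<and>
        w_natural Strict (base C) (base C') \<alpha> \<longrightarrow>
        (\<forall>M\<in>obj (L C).
           prewhisker_trans (base S) \<alpha> (F0 (\<Theta> C) M) =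
           F1 (\<Theta> C') (prewhisker_trans (base S) \<alpha> M)))"
proof -
  interpret cloven_sketch S \<Omega> \<Psi>
    using cloven \<Psi>_def by (rule cloven_sketch.intro)
  have R: "R C = L C" if "is_sketch C" for C
    using loose_FMod[OF that] by (simp add: L_def R_def)
  show ?thesis
  proof (intro exI[of _ "\<lambda>C. id_twofun (L C)"] conjI allI impI ballI; (elim conjE)?)
    fix C :: "('jo, 'jm, 'jn, 'wo, 'wm, 'p, 'q, 'r) sketch" assume "is_sketch C"
    then show "two_cat_iso (L C) (R C) (id_twofun (L C))"
      using two_cat_iso_id[OF two_category_Mod] by (simp add: R) (simp add: L_def)
  next
    fix C C' :: "('jo, 'jm, 'jn, 'wo, 'wm, 'p, 'q, 'r) sketch" and H
    assume C: "is_sketch C" "is_sketch C'" "is_model C C' H"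
    \<comment> \<open>These memberships are what cancels \<open>id_twofun (L C')\<close>, which is
      \<open>undefined\<close> off the carriers of \<open>L C'\<close>.\<close>
    have "comp_twofun (base S) H M \<in> obj (L C')" if "M \<in> obj (L C)" for M
      using that is_model_comp[OF sketch _ C(3)] by (simp add: L_def Mod_sel)
    moreover have "postwhisker_trans (base S) H \<phi> \<in> ar1 (L C')" if "\<phi> \<in> ar1 (L C)" for \<phi>
      using that postwhisker_in_Mod[OF C] by (simp add: L_def)
    moreover have "postwhisker_modif (base S) H \<mu> \<in> ar2 (L C')" if "\<mu> \<in> ar2 (L C)" for \<mu>
      using that postwhisker_modif_in_Mod[OF C] by (simp add: L_def)
    ultimately show "comp_twofun (L C) (postcomp (R C) (base S) H) (id_twofun (L C)) =
        comp_twofun (L C) (id_twofun (L C')) (postcomp (L C) (base S) H)"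
      by (simp add: R[OF C(1)] comp_twofun_def postcomp_def id_twofun_def cong: restrict_cong)
  next
    fix C C' :: "('jo, 'jm, 'jn, 'wo, 'wm, 'p, 'q, 'r) sketch" and \<alpha> M
    assume "is_sketch C" "is_sketch C'" "is_model C C' (tsrc \<alpha>)" "is_model C C' (ttgt \<alpha>)"
      "w_natural Strict (base C) (base C') \<alpha>" and M: "M \<in> obj (L C)"
    then have "prewhisker_trans (base S) \<alpha> M \<in> ar1 (L C')"
      using prewhisker_in_Mod by (simp add: L_def)
    then show "prewhisker_trans (base S) \<alpha> (F0 (id_twofun (L C)) M) =
        F1 (id_twofun (L C')) (prewhisker_trans (base S) \<alpha> M)"
      using M by (simp add: id_twofun_def)
  qed
qed

end
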